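(* Let $(N,\langle\,,\,\rangle)$ be a simply connected $2$-step nilpotent Lie group equipped with a bi-invariant (pseudo-Riemannian) metric, let $\mathfrak{n}$ denote its Lie algebra and $\mathfrak{z}$ the center of $\mathfrak{n}$. Then for any direct sum decomposition of vector spaces $\mathfrak{n}=\mathfrak{z}\oplus\mathfrak{v}$, the automorphism $\mathrm{Ad}(n)$ of $\mathfrak{n}$ does not preserve $\mathfrak{v}$ whenever $n\in N$ is non-central.
   Context: A metric on a Lie group is bi-invariant if both left- and right-translations are isometries. $\mathrm{Ad}$ is the adjoint representation of $N$ on $\mathfrak{n}$. *)

theory Defs
  imports
    "HOL-Analysis.Analysis"
    "HOL-Library.Function_Algebras"
    "HOL-Algebra.Group"
begin

text \<open>
  Pointwise scalar multiplication of functions; together with the pointwise addition of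
  \<^theory>\<open>HOL-Library.Function_Algebras\<close> it makes the notions \<^const>\<open>subspace\<close> and \<^const>\<open>span\<close>
  available for tangent vectors, which are functions from charts to the model space below.
\<close>

instantiation "fun" :: (type, real_vector) real_vector
begin

definition scaleR_fun :: "real \<Rightarrow> ('a \<Rightarrow> 'b) \<Rightarrow> 'a \<Rightarrow> 'b"
  where "scaleR_fun r f = (\<lambda>x. r *\<^sub>R f x)"

instance
  by standard (auto simp: scaleR_fun_def fun_eq_iff plus_fun_def algebra_simps)

end

definition internal_direct_sum :: "'v::real_vector set \<Rightarrow> 'v set \<Rightarrow> 'v set \<Rightarrow> bool"
  where "internal_direct_sum W Y Z \<longleftrightarrow>
    subspace Y \<and> subspace Z \<and> W = {y + z | y z. y \<in> Y \<and> z \<in> Z} \<and> Y \<inter> Z = {0}"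


section \<open>Smooth functions on open subsets of normed spaces\<close>

primrec Ck_on :: "nat \<Rightarrow> 'a::real_normed_vector set \<Rightarrow> ('a \<Rightarrow> 'b::real_normed_vector) \<Rightarrow> bool"
  where
    "Ck_on 0 S f \<longleftrightarrow> continuous_on S f"
  | "Ck_on (Suc k) S f \<longleftrightarrow>
      (\<forall>x\<in>S. f differentiable (at x)) \<and>
      (\<forall>v. Ck_on k S (\<lambda>x. frechet_derivative f (at x) v))"

definition smooth_on :: "'a::real_normed_vector set \<Rightarrow> ('a \<Rightarrow> 'b::real_normed_vector) \<Rightarrow> bool"
  where "smooth_on S f \<longleftrightarrow> (\<forall>k. Ck_on k S f)"


section \<open>Smooth manifolds\<close>

text \<open>
  A chart is a pair of an open domain and a coordinate map; the values of the coordinate map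
  outside the domain are irrelevant.  A manifold is given by a smooth atlas, which need not be
  maximal, and its underlying set is the union of the chart domains.  It carries the subspace
  topology of the ambient type, in which it is open.
\<close>

type_synonym ('a, 'e) chart = "'a set \<times> ('a \<Rightarrow> 'e)"

abbreviation chart_dom :: "('a, 'e) chart \<Rightarrow> 'a set"
  where "chart_dom \<equiv> fst"

abbreviation chart_map :: "('a, 'e) chart \<Rightarrow> 'a \<Rightarrow> 'e"
  where "chart_map \<equiv> snd"

abbreviation chart_inv :: "('a, 'e) chart \<Rightarrow> 'e \<Rightarrow> 'a"
  where "chart_inv c \<equiv> inv_into (chart_dom c) (chart_map c)"

definition is_chart :: "('a::topological_space, 'e::euclidean_space) chart \<Rightarrow> bool"
  where "is_chart c \<longleftrightarrow>
    open (chart_dom c) \<and> open (chart_map c ` chart_dom c) \<and>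
    homeomorphism (chart_dom c) (chart_map c ` chart_dom c) (chart_map c) (chart_inv c)"

definition smooth_atlas ::
    "('a::{t2_space,second_countable_topology}, 'e::euclidean_space) chart set \<Rightarrow> bool"
  where "smooth_atlas A \<longleftrightarrow>
    (\<forall>c\<in>A. is_chart c) \<and>
    (\<forall>c\<in>A. \<forall>d\<in>A.
      smooth_on (chart_map c ` (chart_dom c \<inter> chart_dom d)) (chart_map d \<circ> chart_inv c))"

definition manifold_carrier :: "('a, 'e) chart set \<Rightarrow> 'a set"
  where "manifold_carrier A = (\<Union>c\<in>A. chart_dom c)"

definition charts_at :: "('a, 'e) chart set \<Rightarrow> 'a \<Rightarrow> ('a, 'e) chart set"
  where "charts_at A p = {c \<in> A. p \<in> chart_dom c}"

definition prod_atlas ::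
    "('a, 'e) chart set \<Rightarrow> ('b, 'f) chart set \<Rightarrow> ('a \<times> 'b, 'e \<times> 'f) chart set"
  where "prod_atlas A B =
    {(chart_dom c \<times> chart_dom d, map_prod (chart_map c) (chart_map d)) | c d. c \<in> A \<and> d \<in> B}"

definition smooth_map ::
    "('a::{t2_space,second_countable_topology}, 'e::euclidean_space) chart set \<Rightarrow>
     ('b::{t2_space,second_countable_topology}, 'f::euclidean_space) chart set \<Rightarrow>
     ('a \<Rightarrow> 'b) \<Rightarrow> bool"
  where "smooth_map A B f \<longleftrightarrow>
    f ` manifold_carrier A \<subseteq> manifold_carrier B \<and>
    continuous_on (manifold_carrier A) f \<and>
    (\<forall>c\<in>A. \<forall>d\<in>B.
      smooth_on (chart_map c ` (chart_dom c \<inter> f -` chart_dom d))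
        (chart_map d \<circ> f \<circ> chart_inv c))"


section \<open>Tangent vectors, differentials and vector fields\<close>

text \<open>
  Derivative at \<open>p\<close> of the map \<open>f\<close> read in the chart \<open>c\<close> of the source and the chart \<open>d\<close>
  of the target.
\<close>

definition local_derivative ::
    "('a, 'e::euclidean_space) chart \<Rightarrow> ('b, 'f::euclidean_space) chart \<Rightarrow>
     ('a \<Rightarrow> 'b) \<Rightarrow> 'a \<Rightarrow> 'e \<Rightarrow> 'f"
  where "local_derivative c d f p =
    frechet_derivative (chart_map d \<circ> f \<circ> chart_inv c) (at (chart_map c p))"

text \<open>
  A tangent vector at \<open>p\<close> is a family of coordinate vectors, one for every chart around \<open>p\<close>,
  that transforms under change of charts by the derivative of the transition map.  The value at
  all other charts is fixed to be zero, so that equality and the linear structure of tangent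
  vectors are those of functions.
\<close>

type_synonym ('a, 'e) tangent = "('a, 'e) chart \<Rightarrow> 'e"

definition tangent_space ::
    "('a, 'e::euclidean_space) chart set \<Rightarrow> 'a \<Rightarrow> ('a, 'e) tangent set"
  where "tangent_space A p =
    {v. (\<forall>c. c \<notin> charts_at A p \<longrightarrow> v c = 0) \<and>
        (\<forall>c\<in>charts_at A p. \<forall>d\<in>charts_at A p. v d = local_derivative c d id p (v c))}"

text \<open>
  The tangent vector with coordinates \<open>w\<close> in the chart \<open>c\<close>: for \<open>w\<close> a basis vector, this is
  the coordinate vector field of \<open>c\<close>.
\<close>

definition coord_vector ::
    "('a, 'e::euclidean_space) chart set \<Rightarrow> ('a, 'e) chart \<Rightarrow> 'a \<Rightarrow> 'e \<Rightarrow> ('a, 'e) tangent"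
  where "coord_vector A c p w =
    (\<lambda>d. if d \<in> charts_at A p then local_derivative c d id p w else 0)"

text \<open>
  The differential of \<open>f\<close> at \<open>p\<close>.  By the chain rule, the result does not depend on the chart
  around \<open>p\<close> in which the argument is read.
\<close>

definition differential ::
    "('a, 'e::euclidean_space) chart set \<Rightarrow> ('b, 'f::euclidean_space) chart set \<Rightarrow>
     ('a \<Rightarrow> 'b) \<Rightarrow> 'a \<Rightarrow> ('a, 'e) tangent \<Rightarrow> ('b, 'f) tangent"
  where "differential A B f p v =
    (let c = (SOME c. c \<in> charts_at A p)
     in (\<lambda>d. if d \<in> charts_at B (f p) then local_derivative c d f p (v c) else 0))"

text \<open>
  The Lie bracket of vector fields, \<open>[X, Y]\<^sup>i = X\<^sup>j \<partial>\<^sub>j Y\<^sup>i - Y\<^sup>j \<partial>\<^sub>j X\<^sup>i\<close> in every chart.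
\<close>

definition vector_field_bracket ::
    "('a, 'e::euclidean_space) chart set \<Rightarrow> ('a \<Rightarrow> ('a, 'e) tangent) \<Rightarrow>
     ('a \<Rightarrow> ('a, 'e) tangent) \<Rightarrow> 'a \<Rightarrow> ('a, 'e) tangent"
  where "vector_field_bracket A X Y p =
    (\<lambda>c. if c \<in> charts_at A p
      then frechet_derivative (\<lambda>u. Y (chart_inv c u) c) (at (chart_map c p)) (X p c)
         - frechet_derivative (\<lambda>u. X (chart_inv c u) c) (at (chart_map c p)) (Y p c)
      else 0)"


section \<open>Pseudo-Riemannian metrics and isometries\<close>

text \<open>
  Only the values of \<open>g p\<close> on the tangent space at \<open>p\<close> matter.  Linearity in the second
  argument follows from symmetry.  The signature is arbitrary; by continuity and nondegeneracy
  it is constant on connected manifolds.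
\<close>

definition pseudo_riemannian_metric ::
    "('a, 'e::euclidean_space) chart set \<Rightarrow>
     ('a \<Rightarrow> ('a, 'e) tangent \<Rightarrow> ('a, 'e) tangent \<Rightarrow> real) \<Rightarrow> bool"
  where "pseudo_riemannian_metric A g \<longleftrightarrow>
    (\<forall>p\<in>manifold_carrier A.
      (\<forall>u\<in>tangent_space A p. \<forall>v\<in>tangent_space A p. g p u v = g p v u) \<and>
      (\<forall>u\<in>tangent_space A p. \<forall>v\<in>tangent_space A p. \<forall>w\<in>tangent_space A p. \<forall>a b.
        g p (a *\<^sub>R u + b *\<^sub>R v) w = a * g p u w + b * g p v w) \<and>
      (\<forall>u\<in>tangent_space A p. (\<forall>v\<in>tangent_space A p. g p u v = 0) \<longrightarrow> u = 0)) \<and>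
    (\<forall>c\<in>A. \<forall>w w'. smooth_on (chart_map c ` chart_dom c)
      (\<lambda>x. g (chart_inv c x) (coord_vector A c (chart_inv c x) w)
             (coord_vector A c (chart_inv c x) w')))"

definition isometry ::
    "('a::{t2_space,second_countable_topology}, 'e::euclidean_space) chart set \<Rightarrow>
     ('a \<Rightarrow> ('a, 'e) tangent \<Rightarrow> ('a, 'e) tangent \<Rightarrow> real) \<Rightarrow> ('a \<Rightarrow> 'a) \<Rightarrow> bool"
  where "isometry A g f \<longleftrightarrow>
    bij_betw f (manifold_carrier A) (manifold_carrier A) \<and>
    smooth_map A A f \<and> smooth_map A A (inv_into (manifold_carrier A) f) \<and>
    (\<forall>p\<in>manifold_carrier A. \<forall>u\<in>tangent_space A p. \<forall>v\<in>tangent_space A p.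
      g (f p) (differential A A f p u) (differential A A f p v) = g p u v)"


section \<open>Lie groups\<close>

definition lie_group ::
    "'a monoid \<Rightarrow> ('a::{t2_space,second_countable_topology}, 'e::euclidean_space) chart set \<Rightarrow> bool"
  where "lie_group G A \<longleftrightarrow>
    group G \<and> smooth_atlas A \<and> manifold_carrier A = carrier G \<and>
    smooth_map (prod_atlas A A) A (\<lambda>(x, y). x \<otimes>\<^bsub>G\<^esub> y) \<and>
    smooth_map A A (\<lambda>x. inv\<^bsub>G\<^esub> x)"

definition group_center :: "'a monoid \<Rightarrow> 'a set"
  where "group_center G =
    {x \<in> carrier G. \<forall>y\<in>carrier G. x \<otimes>\<^bsub>G\<^esub> y = y \<otimes>\<^bsub>G\<^esub> x}"

definition bi_invariant_metric ::
    "'a monoid \<Rightarrow> ('a::{t2_space,second_countable_topology}, 'e::euclidean_space) chart set \<Rightarrow>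
     ('a \<Rightarrow> ('a, 'e) tangent \<Rightarrow> ('a, 'e) tangent \<Rightarrow> real) \<Rightarrow> bool"
  where "bi_invariant_metric G A g \<longleftrightarrow>
    pseudo_riemannian_metric A g \<and>
    (\<forall>a\<in>carrier G. isometry A g (\<lambda>x. a \<otimes>\<^bsub>G\<^esub> x) \<and> isometry A g (\<lambda>x. x \<otimes>\<^bsub>G\<^esub> a))"


section \<open>The Lie algebra of a Lie group\<close>

text \<open>
  The Lie algebra is the tangent space at the identity, identified with the left-invariant vector
  fields.
\<close>

definition lie_algebra ::
    "'a monoid \<Rightarrow> ('a, 'e::euclidean_space) chart set \<Rightarrow> ('a, 'e) tangent set"
  where "lie_algebra G A = tangent_space A \<one>\<^bsub>G\<^esub>"

definition left_invariant_field ::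
    "'a monoid \<Rightarrow> ('a, 'e::euclidean_space) chart set \<Rightarrow> ('a, 'e) tangent \<Rightarrow>
     'a \<Rightarrow> ('a, 'e) tangent"
  where "left_invariant_field G A x a = differential A A (\<lambda>h. a \<otimes>\<^bsub>G\<^esub> h) \<one>\<^bsub>G\<^esub> x"

definition lie_bracket ::
    "'a monoid \<Rightarrow> ('a, 'e::euclidean_space) chart set \<Rightarrow> ('a, 'e) tangent \<Rightarrow>
     ('a, 'e) tangent \<Rightarrow> ('a, 'e) tangent"
  where "lie_bracket G A x y =
    vector_field_bracket A (left_invariant_field G A x) (left_invariant_field G A y) \<one>\<^bsub>G\<^esub>"

definition lie_center ::
    "'a monoid \<Rightarrow> ('a, 'e::euclidean_space) chart set \<Rightarrow> ('a, 'e) tangent set"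
  where "lie_center G A =
    {x \<in> lie_algebra G A. \<forall>y\<in>lie_algebra G A. lie_bracket G A x y = 0}"

primrec lower_central_series ::
    "'a monoid \<Rightarrow> ('a, 'e::euclidean_space) chart set \<Rightarrow> nat \<Rightarrow> ('a, 'e) tangent set"
  where
    "lower_central_series G A 0 = lie_algebra G A"
  | "lower_central_series G A (Suc k) =
      span {lie_bracket G A x y | x y. x \<in> lie_algebra G A \<and> y \<in> lower_central_series G A k}"

text \<open>The step is exact: a 2-step nilpotent Lie group is not abelian.\<close>

definition step_nilpotent ::
    "nat \<Rightarrow> 'a monoid \<Rightarrow> ('a, 'e::euclidean_space) chart set \<Rightarrow> bool"
  where "step_nilpotent k G A \<longleftrightarrow>
    lower_central_series G A k = {0} \<and> (\<forall>j<k. lower_central_series G A j \<noteq> {0})"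

definition Ad ::
    "'a monoid \<Rightarrow> ('a, 'e::euclidean_space) chart set \<Rightarrow> 'a \<Rightarrow>
     ('a, 'e) tangent \<Rightarrow> ('a, 'e) tangent"
  where "Ad G A a = differential A A (\<lambda>x. a \<otimes>\<^bsub>G\<^esub> x \<otimes>\<^bsub>G\<^esub> inv\<^bsub>G\<^esub> a) \<one>\<^bsub>G\<^esub>"

end

theory Submission
  imports Defs
begin

text \<open>
  Fix \<open>x\<close> in the Lie algebra of the group \<open>N\<close>.  The map \<open>a \<mapsto> Ad(a) x\<close> has derivative \<open>[y, x]\<close> at the identity in
  direction \<open>y\<close>, hence derivative \<open>Ad(p) [y, x]\<close> at \<open>p\<close> by multiplicativity of \<open>Ad\<close>.  As \<open>N\<close> is
  connected, \<open>Ad(a)\<close> therefore fixes the center pointwise, and if the group is 2-step nilpotent, then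
  \<open>Ad(a) x - x\<close> is central.  If now \<open>Ad(n)\<close> preserves a complement \<open>V\<close> of the center, then
  \<open>Ad(n) v - v\<close> lies in both summands for \<open>v\<close> in \<open>V\<close>, so \<open>Ad(n)\<close> is the identity.  Then the
  commutator map \<open>b \<mapsto> n b n\<^sup>-\<^sup>1 b\<^sup>-\<^sup>1\<close> has vanishing derivative at the identity, by translation
  everywhere, so it is constant and \<open>n\<close> is central.
\<close>

section \<open>Second derivatives\<close>

text \<open>The mean value theorem in direction \<open>v\<close> is applied to the difference of
  \<open>f\<close> in direction \<open>w\<close>. The two values of \<open>f'\<close> that appear
  are expanded to first order at \<open>x\<close>, which uses differentiability of the directional
  derivative at that single point.\<close>

lemma second_difference_tendsto:
  fixes f :: "'a::real_normed_vector \<Rightarrow> real"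
  assumes S: "open S" "x \<in> S" and f: "\<And>y. y \<in> S \<Longrightarrow> (f has_derivative f' y) (at y)"
    and F: "((\<lambda>y. f' y v) has_derivative F) (at x)"
  shows "((\<lambda>h. (f (x + h *\<^sub>R v + h *\<^sub>R w) - f (x + h *\<^sub>R v) - f (x + h *\<^sub>R w) + f x) / h\<^sup>2)
    \<longlongrightarrow> F w) (at_right 0)"
proof (rule tendstoI)
  fix e :: real assume "0 < e"
  \<comment> \<open>All evaluation points lie within \<open>h * K\<close> of \<open>x\<close>; the
    summand 1 keeps \<open>K\<close> positive when \<open>v\<close> and \<open>w\<close> vanish. Two
    errors of size at most \<open>e' * (h * K)\<close> add up to \<open>e / 2\<close> after division
    by \<open>h\<close>.\<close>
  define K where "K = norm v + norm w + 1"
  have K: "K > 0" using norm_ge_zero[of v] norm_ge_zero[of w] by (simp add: K_def add_nonneg_pos)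
  define e' where "e' = e / (4 * K)"
  have e': "e' > 0" using \<open>0 < e\<close> K by (simp add: e'_def)
  interpret F: bounded_linear F using F by (rule has_derivative_bounded_linear)
  obtain d1 where d1: "d1 > 0" "\<And>y. norm (y - x) < d1 \<Longrightarrow>
      \<bar>f' y v - f' x v - F (y - x)\<bar> \<le> e' * norm (y - x)"
    using F e' unfolding has_derivative_at_alt by (metis real_norm_def)
  obtain d2 where d2: "d2 > 0" "ball x d2 \<subseteq> S"
    using S by (auto simp: open_contains_ball)
  define d where "d = min d1 d2"
  have d: "d > 0" using d1 d2 by (simp add: d_def)
  have small: "norm (s *\<^sub>R v + t *\<^sub>R w) \<le> h * K \<and> norm (s *\<^sub>R v + t *\<^sub>R w) < d"
    if "0 \<le> s" "s \<le> h" "0 \<le> t" "t \<le> h" "0 < h" "h < d / K" for s t h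
  proof -
    have "norm (s *\<^sub>R v + t *\<^sub>R w) \<le> s * norm v + t * norm w"
      using norm_triangle_ineq[of "s *\<^sub>R v" "t *\<^sub>R w"] that by simp
    also have "\<dots> \<le> h * norm v + h * norm w"
      using that by (intro add_mono mult_right_mono) auto
    also have "\<dots> \<le> h * K" using that by (simp add: K_def algebra_simps)
    finally show ?thesis using that K by (auto simp: field_simps)
  qed
  have "dist ((f (x + h *\<^sub>R v + h *\<^sub>R w) - f (x + h *\<^sub>R v) - f (x + h *\<^sub>R w) + f x) / h\<^sup>2) (F w) < e"
    if h: "0 < h" "h < d / K" for h
  proof -
    define g where "g s = f (x + s *\<^sub>R v + h *\<^sub>R w) - f (x + s *\<^sub>R v)" for s
    have inS: "x + s *\<^sub>R v + t *\<^sub>R w \<in> S" if "0 \<le> s" "s \<le> h" "0 \<le> t" "t \<le> h" for s t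
    proof -
      have "norm (s *\<^sub>R v + t *\<^sub>R w) < d2" using small[OF that h] by (simp add: d_def)
      then show ?thesis using d2 by (auto simp: dist_norm norm_minus_commute subset_iff
            add.assoc norm_minus_cancel minus_add_distrib[symmetric] simp del: minus_add_distrib)
    qed
    have g: "(g has_derivative (\<lambda>r. r * (f' (x + s *\<^sub>R v + h *\<^sub>R w) v - f' (x + s *\<^sub>R v) v))) (at s)"
      if s: "0 \<le> s" "s \<le> h" for s
    proof -
      have a: "(f has_derivative f' (x + s *\<^sub>R v + h *\<^sub>R w)) (at (x + s *\<^sub>R v + h *\<^sub>R w))"
        using inS[OF s, of h] h by (auto intro: f)
      have b: "(f has_derivative f' (x + s *\<^sub>R v)) (at (x + s *\<^sub>R v))"
        using inS[OF s, of 0] h by (auto intro: f)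
      have "(g has_derivative (\<lambda>r. f' (x + s *\<^sub>R v + h *\<^sub>R w) (r *\<^sub>R v) - f' (x + s *\<^sub>R v) (r *\<^sub>R v))) (at s)"
        unfolding g_def
        by (intro has_derivative_diff
            has_derivative_compose[where f = "\<lambda>s. x + s *\<^sub>R v + h *\<^sub>R w", OF _ a]
            has_derivative_compose[where f = "\<lambda>s. x + s *\<^sub>R v", OF _ b])
           (auto intro!: derivative_eq_intros)
      then show ?thesis
        using has_derivative_bounded_linear[OF a] has_derivative_bounded_linear[OF b]
        by (simp add: linear_simps algebra_simps)
    qed
    have "\<exists>\<sigma>\<in>{0..h}. g h - g 0 =
        (h - 0) * (f' (x + \<sigma> *\<^sub>R v + h *\<^sub>R w) v - f' (x + \<sigma> *\<^sub>R v) v)"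
      by (rule mvt_very_simple[OF less_imp_le[OF h(1)]]) (auto intro: has_derivative_at_withinI[OF g])
    then obtain \<sigma> where \<sigma>: "0 \<le> \<sigma>" "\<sigma> \<le> h"
      "g h - g 0 = h * (f' (x + \<sigma> *\<^sub>R v + h *\<^sub>R w) v - f' (x + \<sigma> *\<^sub>R v) v)"
      by auto
    \<comment> \<open>These are first-order remainders at \<open>x\<close>. The linear parts differ
      by \<open>F (h *\<^sub>R w)\<close>, which is the main term.\<close>
    define A B where "A = f' (x + \<sigma> *\<^sub>R v + h *\<^sub>R w) v - f' x v - F (\<sigma> *\<^sub>R v + h *\<^sub>R w)"
      and "B = f' (x + \<sigma> *\<^sub>R v) v - f' x v - F (\<sigma> *\<^sub>R v)"
    have s1: "norm (\<sigma> *\<^sub>R v + h *\<^sub>R w) \<le> h * K" "norm (\<sigma> *\<^sub>R v + h *\<^sub>R w) < d1"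
      using small[of \<sigma> h h] \<sigma> h by (auto simp: d_def)
    have s2: "norm (\<sigma> *\<^sub>R v) \<le> h * K" "norm (\<sigma> *\<^sub>R v) < d1"
      using small[of \<sigma> h 0] \<sigma> h by (auto simp: d_def)
    have "\<bar>A\<bar> \<le> e' * norm (\<sigma> *\<^sub>R v + h *\<^sub>R w)"
      using d1(2)[of "x + \<sigma> *\<^sub>R v + h *\<^sub>R w"] s1 by (simp add: A_def add.assoc)
    also have "\<dots> \<le> e' * (h * K)" using s1 e' by (simp add: mult_left_mono)
    finally have A: "\<bar>A\<bar> \<le> e' * (h * K)" .
    have "\<bar>B\<bar> \<le> e' * norm (\<sigma> *\<^sub>R v)"
      using d1(2)[of "x + \<sigma> *\<^sub>R v"] s2 by (simp add: B_def)
    also have "\<dots> \<le> e' * (h * K)" using s2 e' by (simp add: mult_left_mono)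
    finally have B: "\<bar>B\<bar> \<le> e' * (h * K)" .
    have "g h - g 0 = h * (h * F w + A - B)"
      unfolding \<sigma>(3) A_def B_def by (simp add: F.add F.scaleR)
    then have "(g h - g 0) / h\<^sup>2 = (h * F w + A - B) / h"
      using h by (simp add: power2_eq_square)
    then have "(g h - g 0) / h\<^sup>2 - F w = (A - B) / h"
      using h by (simp add: field_simps)
    then have "\<bar>(g h - g 0) / h\<^sup>2 - F w\<bar> = \<bar>A - B\<bar> / h"
      using h by simp
    also have "\<dots> \<le> (2 * e' * (h * K)) / h"
      using A B h by (intro divide_right_mono) linarith+
    also have "\<dots> < e" using h K \<open>0 < e\<close> by (simp add: e'_def)
    finally show ?thesis by (simp add: g_def dist_real_def algebra_simps)
  qed
  then show "\<forall>\<^sub>F h in at_right 0. dist ((f (x + h *\<^sub>R v + h *\<^sub>R w) - f (x + h *\<^sub>R v) -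
      f (x + h *\<^sub>R w) + f x) / h\<^sup>2) (F w) < e"
    unfolding eventually_at_right_field using d K by (intro exI[of _ "d / K"]) auto
qed

text \<open>The second difference quotient is symmetric in \<open>v\<close> and \<open>w\<close>, so
  both sides are limits of the same function.\<close>

lemma symmetric_second_derivative_real:
  fixes f :: "'a::real_normed_vector \<Rightarrow> real"
  assumes S: "open S" "x \<in> S" and f: "\<And>y. y \<in> S \<Longrightarrow> (f has_derivative f' y) (at y)"
    and F: "((\<lambda>y. f' y v) has_derivative F) (at x)"
    and G: "((\<lambda>y. f' y w) has_derivative G) (at x)"
  shows "F w = G v"
proof (rule tendsto_unique[OF _ second_difference_tendsto[OF S f F]])
  show "((\<lambda>h. (f (x + h *\<^sub>R v + h *\<^sub>R w) - f (x + h *\<^sub>R v) - f (x + h *\<^sub>R w) + f x) / h\<^sup>2)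
    \<longlongrightarrow> G v) (at_right 0)"
    using second_difference_tendsto[OF S f G, of v] by (simp add: algebra_simps)
qed auto

lemma symmetric_second_derivative:
  fixes f :: "'a::real_normed_vector \<Rightarrow> 'b::real_inner"
  assumes S: "open S" "x \<in> S" and f: "\<And>y. y \<in> S \<Longrightarrow> (f has_derivative f' y) (at y)"
    and F: "((\<lambda>y. f' y v) has_derivative F) (at x)"
    and G: "((\<lambda>y. f' y w) has_derivative G) (at x)"
  shows "F w = G v"
proof -
  have "F w \<bullet> b = G v \<bullet> b" for b
    by (rule symmetric_second_derivative_real[OF S has_derivative_inner_left[OF f]
          has_derivative_inner_left[OF F] has_derivative_inner_left[OF G]])
  then show ?thesis using inner_eq_zero_iff[of "F w - G v"] by (simp add: inner_diff_left)
qed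

text \<open>A product rule for an operator \<open>L u\<close> applied to a moving vector.
  Differentiability is assumed for each fixed vector only; expanding \<open>g u\<close> in the
  finite basis leaves finitely many scalar coefficients times the functions
  \<open>L u b\<close>.\<close>

lemma has_derivative_linear_apply:
  fixes L :: "'x::real_normed_vector \<Rightarrow> 'e::euclidean_space \<Rightarrow> 'f::real_normed_vector"
  assumes lin: "\<forall>\<^sub>F u in nhds x. linear (L u)"
    and L: "\<And>v. ((\<lambda>u. L u v) has_derivative L' v) (at x)"
    and g: "(g has_derivative g') (at x)"
  shows "((\<lambda>u. L u (g u)) has_derivative (\<lambda>h. L x (g' h) + L' (g x) h)) (at x)"
proof -
  have exp: "k w = (\<Sum>b\<in>Basis. (w \<bullet> b) *\<^sub>R k b)" if "linear k" for k :: "'e \<Rightarrow> 'f" and w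
    using linear_sum[OF that, of "\<lambda>b. (w \<bullet> b) *\<^sub>R b" Basis]
    by (simp add: euclidean_representation linear_cmul[OF that])
  have linx: "linear (L x)" using lin by (rule eventually_nhds_x_imp_x)
  have ev: "\<forall>\<^sub>F u in at x. linear (L u)" using lin by (simp add: eventually_at_filter eventually_mono)
  \<comment> \<open>Linearity of \<open>L'\<close> in the vector argument follows from uniqueness of
    the derivative.\<close>
  have L'_expand: "L' w = (\<lambda>h. \<Sum>b\<in>Basis. (w \<bullet> b) *\<^sub>R L' b h)" for w
  proof (rule has_derivative_unique[OF L])
    have "((\<lambda>u. \<Sum>b\<in>Basis. (w \<bullet> b) *\<^sub>R L u b) has_derivative
        (\<lambda>h. \<Sum>b\<in>Basis. (w \<bullet> b) *\<^sub>R L' b h)) (at x)"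
      by (intro has_derivative_sum has_derivative_scaleR_right L)
    then show "((\<lambda>u. L u w) has_derivative (\<lambda>h. \<Sum>b\<in>Basis. (w \<bullet> b) *\<^sub>R L' b h)) (at x)"
      by (rule has_derivative_transform_eventually) (use ev linx in \<open>auto elim!: eventually_mono simp: exp\<close>)
  qed
  have "((\<lambda>u. \<Sum>b\<in>Basis. (g u \<bullet> b) *\<^sub>R L u b) has_derivative
      (\<lambda>h. \<Sum>b\<in>Basis. (g x \<bullet> b) *\<^sub>R L' b h + (g' h \<bullet> b) *\<^sub>R L x b)) (at x)"
    by (intro has_derivative_sum has_derivative_scaleR L has_derivative_inner_left g)
  then have "((\<lambda>u. L u (g u)) has_derivative
      (\<lambda>h. \<Sum>b\<in>Basis. (g x \<bullet> b) *\<^sub>R L' b h + (g' h \<bullet> b) *\<^sub>R L x b)) (at x)"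
    by (rule has_derivative_transform_eventually) (use ev linx in \<open>auto elim!: eventually_mono simp: exp\<close>)
  then show ?thesis
    by (subst L'_expand, subst exp[OF linx]) (simp add: sum.distrib add.commute)
qed


section \<open>Derivatives of maps between manifolds\<close>

context
  fixes c :: "('a::t2_space, 'e::euclidean_space) chart"
  assumes c: "is_chart c"
begin

lemma chart_inv_map: "p \<in> chart_dom c \<Longrightarrow> chart_inv c (chart_map c p) = p"
  using c by (auto simp: is_chart_def intro: homeomorphism_apply1)

lemma chart_map_inv: "u \<in> chart_map c ` chart_dom c \<Longrightarrow> chart_map c (chart_inv c u) = u"
  by (rule f_inv_into_f)

lemma chart_inv_in_dom: "u \<in> chart_map c ` chart_dom c \<Longrightarrow> chart_inv c u \<in> chart_dom c"
  by (rule inv_into_into)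

lemma open_chart_dom: "open (chart_dom c)"
  using c by (simp add: is_chart_def)

lemma open_chart_image: "open (chart_map c ` chart_dom c)"
  using c by (simp add: is_chart_def)

lemma open_chart_image_of_open:
  assumes "open W" "W \<subseteq> chart_dom c"
  shows "open (chart_map c ` W)"
proof -
  have h: "homeomorphism (chart_map c ` chart_dom c) (chart_dom c) (chart_inv c) (chart_map c)"
    using c by (auto simp: is_chart_def intro: homeomorphism_symD)
  have "chart_map c ` W = chart_map c ` chart_dom c \<inter> chart_inv c -` W"
    using assms by (force simp: chart_inv_map)
  moreover have "open \<dots>"
    using h assms open_chart_image by (intro continuous_open_preimage) (auto simp: homeomorphism_def)
  ultimately show ?thesis by simp
qed

lemma eventually_chart_image:
  "p \<in> chart_dom c \<Longrightarrow> \<forall>\<^sub>F u in nhds (chart_map c p). u \<in> chart_map c ` chart_dom c"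
  using open_chart_image by (rule eventually_nhds_in_open) simp

lemma isCont_chart_map: "p \<in> chart_dom c \<Longrightarrow> isCont (chart_map c) p"
  using c by (auto simp: is_chart_def homeomorphism_def continuous_on_eq_continuous_at)

lemma isCont_chart_inv: "p \<in> chart_dom c \<Longrightarrow> isCont (chart_inv c) (chart_map c p)"
  using c by (auto simp: is_chart_def homeomorphism_def continuous_on_eq_continuous_at)

text \<open>Coordinate expressions are often meaningful only near a point. This lemma and
  \<open>eventually_chart_map\<close> carry such neighbourhood statements into coordinates and
  back.\<close>

lemma eventually_chart_inv:
  assumes "p \<in> chart_dom c" "\<forall>\<^sub>F q in nhds p. P q"
  shows "\<forall>\<^sub>F u in nhds (chart_map c p). P (chart_inv c u)"
proof -
  have "filterlim (chart_inv c) (nhds (chart_inv c (chart_map c p))) (nhds (chart_map c p))"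
    using isCont_chart_inv[OF assms(1)] by (simp add: isCont_def tendsto_at_iff_tendsto_nhds)
  then show ?thesis
    using assms by (auto intro: eventually_compose_filterlim simp: chart_inv_map)
qed

lemma eventually_chart_map:
  assumes "p \<in> chart_dom c" "\<forall>\<^sub>F u in nhds (chart_map c p). P u"
  shows "\<forall>\<^sub>F q in nhds p. P (chart_map c q)"
proof -
  have "filterlim (chart_map c) (nhds (chart_map c p)) (nhds p)"
    using isCont_chart_map[OF assms(1)] by (simp add: isCont_def tendsto_at_iff_tendsto_nhds)
  then show ?thesis using assms(2) by (rule eventually_compose_filterlim[rotated])
qed

end

section \<open>Product charts\<close>

definition prod_chart :: "('a, 'e) chart \<Rightarrow> ('b, 'f) chart \<Rightarrow> ('a \<times> 'b, 'e \<times> 'f) chart"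
  where "prod_chart c d = (chart_dom c \<times> chart_dom d, map_prod (chart_map c) (chart_map d))"

lemma prod_chart_simps [simp]:
  "chart_dom (prod_chart c d) = chart_dom c \<times> chart_dom d"
  "chart_map (prod_chart c d) (p, q) = (chart_map c p, chart_map d q)"
  "chart_map (prod_chart c d) = map_prod (chart_map c) (chart_map d)"
  by (simp_all add: prod_chart_def)

lemma chart_inv_prod_chart:
  fixes c :: "('a::t2_space, 'e::euclidean_space) chart"
    and d :: "('b::t2_space, 'f::euclidean_space) chart"
  assumes "is_chart c" "is_chart d" "u \<in> chart_map c ` chart_dom c" "w \<in> chart_map d ` chart_dom d"
  shows "chart_inv (prod_chart c d) (u, w) = (chart_inv c u, chart_inv d w)"
proof (rule inv_into_f_eq)
  have "inj_on (chart_map c) (chart_dom c)" "inj_on (chart_map d) (chart_dom d)"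
    using chart_inv_map[OF assms(1)] chart_inv_map[OF assms(2)] by (auto intro: inj_on_inverseI)
  then show "inj_on (chart_map (prod_chart c d)) (chart_dom (prod_chart c d))"
    by (auto intro: map_prod_inj_on)
qed (use assms in \<open>auto simp: f_inv_into_f inv_into_into\<close>)

lemma is_chart_prod_chart:
  fixes c :: "('a::t2_space, 'e::euclidean_space) chart"
    and d :: "('b::t2_space, 'f::euclidean_space) chart"
  assumes c: "is_chart c" and d: "is_chart d"
  shows "is_chart (prod_chart c d)"
proof -
  have "homeomorphism (chart_dom c \<times> chart_dom d)
      (map_prod (chart_map c) (chart_map d) ` (chart_dom c \<times> chart_dom d))
      (map_prod (chart_map c) (chart_map d)) (chart_inv (prod_chart c d))"
  proof (rule homeomorphismI)
    have "continuous_on (chart_dom c \<times> chart_dom d) (\<lambda>z. (chart_map c (fst z), chart_map d (snd z)))"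
      using c d
      by (intro continuous_on_Pair continuous_on_compose2[of "chart_dom c" "chart_map c" _ fst]
            continuous_on_compose2[of "chart_dom d" "chart_map d" _ snd] continuous_on_fst
            continuous_on_snd continuous_on_id) (auto simp: is_chart_def homeomorphism_def)
    then show "continuous_on (chart_dom c \<times> chart_dom d) (map_prod (chart_map c) (chart_map d))"
      by (simp add: map_prod_def case_prod_unfold)
    have "continuous_on (chart_map c ` chart_dom c \<times> chart_map d ` chart_dom d)
        (\<lambda>z. (chart_inv c (fst z), chart_inv d (snd z)))"
      using c d
      by (intro continuous_on_Pair
            continuous_on_compose2[of "chart_map c ` chart_dom c" "chart_inv c" _ fst]
            continuous_on_compose2[of "chart_map d ` chart_dom d" "chart_inv d" _ snd]
            continuous_on_fst continuous_on_snd continuous_on_id)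
         (auto simp: is_chart_def homeomorphism_def)
    then show "continuous_on (map_prod (chart_map c) (chart_map d) ` (chart_dom c \<times> chart_dom d))
        (chart_inv (prod_chart c d))"
      by (rule continuous_on_eq[OF continuous_on_subset]) (auto simp: chart_inv_prod_chart[OF c d, simplified])
  qed (auto simp: chart_inv_prod_chart[OF c d, simplified] chart_inv_map[OF c] chart_inv_map[OF d])
  moreover have "open (chart_dom c \<times> chart_dom d)"
    using c d by (simp add: open_Times open_chart_dom)
  moreover have "open (map_prod (chart_map c) (chart_map d) ` (chart_dom c \<times> chart_dom d))"
    using c d by (simp add: map_prod_surj_on[OF refl refl] open_Times open_chart_image)
  ultimately show ?thesis by (simp add: is_chart_def)
qed

text \<open>
  Requiring continuity ensures that near \<open>p\<close> the coordinate expression of \<open>f\<close> involves no values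
  of the coordinate maps outside of their domains.
\<close>

definition has_mderiv ::
    "('a::t2_space, 'e::euclidean_space) chart \<Rightarrow> ('b::t2_space, 'f::euclidean_space) chart \<Rightarrow>
     ('a \<Rightarrow> 'b) \<Rightarrow> 'a \<Rightarrow> ('e \<Rightarrow> 'f) \<Rightarrow> bool"
  where "has_mderiv c d f p D \<longleftrightarrow>
    is_chart c \<and> is_chart d \<and> p \<in> chart_dom c \<and> f p \<in> chart_dom d \<and> isCont f p \<and>
    ((chart_map d \<circ> f \<circ> chart_inv c) has_derivative D) (at (chart_map c p))"

lemma has_mderivD:
  assumes "has_mderiv c d f p D"
  shows "is_chart c" "is_chart d" "p \<in> chart_dom c" "f p \<in> chart_dom d" "isCont f p"
    "((chart_map d \<circ> f \<circ> chart_inv c) has_derivative D) (at (chart_map c p))"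
  using assms by (auto simp: has_mderiv_def)

lemma has_derivative_transform_nhds:
  assumes "(f has_derivative D) (at x)" "\<forall>\<^sub>F u in nhds x. f u = g u"
  shows "(g has_derivative D) (at x)"
  using assms(1)
proof (rule has_derivative_transform_eventually)
  show "\<forall>\<^sub>F u in at x. f u = g u"
    using assms(2) by (simp add: eventually_at_filter eventually_mono)
qed (use eventually_nhds_x_imp_x[OF assms(2)] in auto)

lemma has_mderiv_linear: "has_mderiv c d f p D \<Longrightarrow> linear D"
  by (auto simp: has_mderiv_def dest: has_derivative_linear)

lemma has_mderiv_bounded_linear: "has_mderiv c d f p D \<Longrightarrow> bounded_linear D"
  by (auto simp: has_mderiv_def dest: has_derivative_bounded_linear)

lemma has_mderiv_unique: "has_mderiv c d f p D \<Longrightarrow> has_mderiv c d f p D' \<Longrightarrow> D = D'"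
  by (auto simp: has_mderiv_def dest: has_derivative_unique)

lemma has_mderiv_eventually_dom:
  assumes "has_mderiv c d f p D"
  shows "\<forall>\<^sub>F q in nhds p. f q \<in> chart_dom d"
proof -
  note f = has_mderivD[OF assms]
  have "filterlim f (nhds (f p)) (nhds p)"
    using f by (simp add: isCont_def tendsto_at_iff_tendsto_nhds)
  moreover have "\<forall>\<^sub>F y in nhds (f p). y \<in> chart_dom d"
    using f by (intro eventually_nhds_in_open open_chart_dom)
  ultimately show ?thesis by (rule eventually_compose_filterlim[rotated])
qed

lemma local_derivative_eq: "has_mderiv c d f p D \<Longrightarrow> local_derivative c d f p = D"
  by (auto simp: has_mderiv_def local_derivative_def dest: frechet_derivative_at)

text \<open>Cancellation in the group holds only on the carrier. As the carrier is open, locality of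
  derivatives is what allows such identities to be used under a derivative.\<close>

lemma has_mderiv_cong:
  assumes f: "has_mderiv c d f p D" and ev: "\<forall>\<^sub>F q in nhds p. f q = g q"
  shows "has_mderiv c d g p D"
proof -
  note h = has_mderivD[OF f]
  have "isCont g p" using h(5) isCont_cong[OF ev] by simp
  moreover have "f p = g p" using ev by (rule eventually_nhds_x_imp_x)
  moreover have "((chart_map d \<circ> g \<circ> chart_inv c) has_derivative D) (at (chart_map c p))"
    by (rule has_derivative_transform_nhds[OF h(6)])
       (use eventually_chart_inv[OF h(1,3) ev] in \<open>auto elim: eventually_mono\<close>)
  ultimately show ?thesis using h by (simp add: has_mderiv_def)
qed

text \<open>In the composite of the coordinate expressions, \<open>chart_inv d\<close> and
  \<open>chart_map d\<close> cancel only while \<open>f\<close> stays in the domain of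
  \<open>d\<close>; continuity guarantees this near \<open>p\<close>.\<close>

lemma has_mderiv_compose:
  assumes f: "has_mderiv c d f p D" and g: "has_mderiv d e g (f p) E"
  shows "has_mderiv c e (\<lambda>x. g (f x)) p (\<lambda>v. E (D v))"
proof -
  note f' = has_mderivD[OF f] and g' = has_mderivD[OF g]
  have "((chart_map e \<circ> g \<circ> chart_inv d \<circ> (chart_map d \<circ> f \<circ> chart_inv c)) has_derivative E \<circ> D)
      (at (chart_map c p))"
    using f' g' by (intro diff_chain_at) (auto simp: chart_inv_map)
  then have "((chart_map e \<circ> (\<lambda>x. g (f x)) \<circ> chart_inv c) has_derivative E \<circ> D) (at (chart_map c p))"
    by (rule has_derivative_transform_nhds)
       (use eventually_chart_inv[OF f'(1,3) has_mderiv_eventually_dom[OF f]] f'(2)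
        in \<open>auto elim!: eventually_mono simp: chart_inv_map\<close>)
  moreover have "isCont (\<lambda>x. g (f x)) p"
    using f'(5) g'(5) by (rule isCont_o2)
  ultimately show ?thesis using f' g' by (simp add: has_mderiv_def o_def)
qed

lemma has_mderiv_ident:
  assumes "is_chart c" "p \<in> chart_dom c"
  shows "has_mderiv c c (\<lambda>x. x) p (\<lambda>v. v)"
proof -
  have "((chart_map c \<circ> (\<lambda>x. x) \<circ> chart_inv c) has_derivative (\<lambda>v. v)) (at (chart_map c p))"
    by (rule has_derivative_transform_nhds[OF has_derivative_ident])
       (use eventually_chart_image[OF assms] in \<open>auto elim!: eventually_mono simp: chart_map_inv[OF assms(1)]\<close>)
  then show ?thesis using assms by (simp add: has_mderiv_def)
qed

lemma has_mderiv_const: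
  assumes "is_chart c" "p \<in> chart_dom c" "is_chart d" "q \<in> chart_dom d"
  shows "has_mderiv c d (\<lambda>_. q) p (\<lambda>_. 0)"
  using assms by (simp add: has_mderiv_def o_def)

lemma has_mderiv_Pair:
  assumes f: "has_mderiv c d f p D" and g: "has_mderiv c e g p E"
  shows "has_mderiv c (prod_chart d e) (\<lambda>x. (f x, g x)) p (\<lambda>v. (D v, E v))"
proof -
  note f' = has_mderivD[OF f] and g' = has_mderivD[OF g]
  show ?thesis
    using f' g' has_derivative_Pair[OF f'(6) g'(6)]
    by (auto simp: has_mderiv_def is_chart_prod_chart o_def intro!: continuous_intros)
qed

section \<open>From smoothness to derivatives in charts\<close>

lemma smooth_on_differentiable: "smooth_on S f \<Longrightarrow> x \<in> S \<Longrightarrow> f differentiable (at x)"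
  unfolding smooth_on_def by (drule spec[of _ "Suc 0"]) simp

lemma smooth_on_frechet_derivative_differentiable:
  "smooth_on S f \<Longrightarrow> x \<in> S \<Longrightarrow> (\<lambda>x. frechet_derivative f (at x) v) differentiable (at x)"
  unfolding smooth_on_def by (drule spec[of _ "Suc (Suc 0)"]) simp

lemma smooth_map_has_mderiv:
  assumes "smooth_map A B f" "c \<in> A" "d \<in> B" "is_chart c" "is_chart d"
    and "open (manifold_carrier A)" "p \<in> chart_dom c" "f p \<in> chart_dom d"
  shows "has_mderiv c d f p (local_derivative c d f p)"
proof -
  have "p \<in> manifold_carrier A" using assms by (auto simp: manifold_carrier_def)
  then have "isCont f p"
    using assms by (auto simp: smooth_map_def continuous_on_eq_continuous_at)
  moreover have "(chart_map d \<circ> f \<circ> chart_inv c) differentiable (at (chart_map c p))"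
    using assms by (intro smooth_on_differentiable[of "chart_map c ` (chart_dom c \<inter> f -` chart_dom d)"])
      (auto simp: smooth_map_def)
  ultimately show ?thesis
    using assms by (simp add: has_mderiv_def local_derivative_def frechet_derivative_works[symmetric])
qed

section \<open>Tangent spaces and differentials over an atlas\<close>

context
  fixes A :: "('a::{t2_space,second_countable_topology}, 'e::euclidean_space) chart set"
  assumes A: "smooth_atlas A"
begin

lemma is_chart_atlas: "c \<in> A \<Longrightarrow> is_chart c"
  using A by (simp add: smooth_atlas_def)

lemma open_manifold_carrier: "open (manifold_carrier A)"
  unfolding manifold_carrier_def by (intro open_UN ballI open_chart_dom is_chart_atlas)

lemma has_mderiv_transition:
  assumes "c \<in> charts_at A p" "d \<in> charts_at A p"
  shows "has_mderiv c d (\<lambda>x. x) p (local_derivative c d id p)"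
proof -
  have "(chart_map d \<circ> chart_inv c) differentiable (at (chart_map c p))"
    using assms A by (intro smooth_on_differentiable[of "chart_map c ` (chart_dom c \<inter> chart_dom d)"])
      (auto simp: smooth_atlas_def charts_at_def)
  then show ?thesis
    using assms by (auto simp: has_mderiv_def local_derivative_def charts_at_def is_chart_atlas
        o_def frechet_derivative_works[symmetric])
qed

lemma tangent_space_outside: "v \<in> tangent_space A p \<Longrightarrow> c \<notin> charts_at A p \<Longrightarrow> v c = 0"
  unfolding tangent_space_def by blast

lemma tangent_space_transform:
  "v \<in> tangent_space A p \<Longrightarrow> c \<in> charts_at A p \<Longrightarrow> d \<in> charts_at A p \<Longrightarrow>
    v d = local_derivative c d id p (v c)"
  unfolding tangent_space_def by blast

text \<open>Transition derivatives recover all coordinates from those in one chart. Equations in the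
  Lie algebra are therefore checked in a single chart at the identity.\<close>

lemma tangent_space_eqI:
  assumes "v \<in> tangent_space A p" "w \<in> tangent_space A p" "c \<in> charts_at A p" "v c = w c"
  shows "v = w"
proof
  fix d show "v d = w d"
  proof (cases "d \<in> charts_at A p")
    case True
    then show ?thesis using assms tangent_space_transform by metis
  qed (use assms tangent_space_outside in metis)
qed

lemma tangent_space_add_diff:
  assumes v: "v \<in> tangent_space A p" and w: "w \<in> tangent_space A p"
  shows "v + w \<in> tangent_space A p" "v - w \<in> tangent_space A p"
proof -
  have lin: "linear (local_derivative c d id p)" if "c \<in> charts_at A p" "d \<in> charts_at A p" for c d
    using has_mderiv_transition[OF that] by (rule has_mderiv_linear)
  have "(v + w) d = local_derivative c d id p ((v + w) c)"
    "(v - w) d = local_derivative c d id p ((v - w) c)"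
    if "c \<in> charts_at A p" "d \<in> charts_at A p" for c d
    by (simp_all only: plus_fun_apply minus_apply linear_add[OF lin[OF that]] linear_diff[OF lin[OF that]]
        tangent_space_transform[OF v that, symmetric] tangent_space_transform[OF w that, symmetric])
  moreover have "(v + w) c = 0" "(v - w) c = 0" if "c \<notin> charts_at A p" for c
    using tangent_space_outside[OF v that] tangent_space_outside[OF w that] by simp_all
  ultimately show "v + w \<in> tangent_space A p" "v - w \<in> tangent_space A p"
    unfolding tangent_space_def by blast+
qed

lemma coord_vector:
  assumes c: "c \<in> charts_at A p"
  shows "coord_vector A c p w \<in> tangent_space A p" "coord_vector A c p w c = w"
proof -
  \<comment> \<open>The cocycle identity: the chain rule for the transition from \<open>c\<close> to
    \<open>e\<close> through \<open>d\<close>.\<close>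
  have transport: "local_derivative c e id p w = local_derivative d e id p (local_derivative c d id p w)"
    if "d \<in> charts_at A p" "e \<in> charts_at A p" for d e
    using has_mderiv_unique[OF has_mderiv_transition[OF c that(2)]
        has_mderiv_compose[OF has_mderiv_transition[OF c that(1)] has_mderiv_transition[OF that]]]
    by (rule fun_cong)
  have "coord_vector A c p w e = local_derivative d e id p (coord_vector A c p w d)"
    if "d \<in> charts_at A p" "e \<in> charts_at A p" for d e
    by (simp only: coord_vector_def that if_True transport[OF that, symmetric])
  moreover have "coord_vector A c p w d = 0" if "d \<notin> charts_at A p" for d
    using that by (simp only: coord_vector_def if_False)
  ultimately show "coord_vector A c p w \<in> tangent_space A p"
    unfolding tangent_space_def by blast
  have "local_derivative c c id p = (\<lambda>v. v)"
    using has_mderiv_transition[OF c c] c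
    by (intro has_mderiv_unique[OF _ has_mderiv_ident]) (auto simp: charts_at_def is_chart_atlas)
  then show "coord_vector A c p w c = w" using c by (simp add: coord_vector_def)
qed

text \<open>The definition reads \<open>v\<close> in a chart picked by \<open>SOME\<close>.
  Precomposing with the transition from that chart to \<open>c\<close> and applying the chain rule
  removes the choice.\<close>

lemma differential_eq:
  assumes f: "has_mderiv c d f p D" and cd: "c \<in> A" "d \<in> B" and v: "v \<in> tangent_space A p"
  shows "differential A B f p v d = D (v c)"
proof -
  note f' = has_mderivD[OF f]
  define c0 where "c0 = (SOME c. c \<in> charts_at A p)"
  have c: "c \<in> charts_at A p" and d: "d \<in> charts_at B (f p)"
    using f' cd by (auto simp: charts_at_def)
  have c0: "c0 \<in> charts_at A p" unfolding c0_def using c by (rule someI)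
  note T = has_mderiv_transition[OF c0 c]
  have "local_derivative c0 d f p = (\<lambda>v. D (local_derivative c0 c id p v))"
    using has_mderiv_compose[OF T f] by (rule local_derivative_eq)
  moreover have "v c = local_derivative c0 c id p (v c0)"
    using v c0 c by (rule tangent_space_transform)
  ultimately show ?thesis using d by (simp add: differential_def c0_def[symmetric])
qed

end

lemma differential_tangent_space:
  assumes A: "smooth_atlas A" and B: "smooth_atlas B"
    and f: "has_mderiv c d f p D" and cd: "c \<in> A" "d \<in> B" and v: "v \<in> tangent_space A p"
  shows "differential A B f p v \<in> tangent_space B (f p)"
proof -
  have d: "d \<in> charts_at B (f p)" using has_mderivD[OF f] cd by (simp add: charts_at_def)
  \<comment> \<open>Composing \<open>f\<close> with the transition to \<open>e\<close> shows that
    the image is the coordinate vector of \<open>D (v c)\<close> in the chart \<open>d\<close>, and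
    coordinate vectors are tangent.\<close>
  have "differential A B f p v e = local_derivative d e id (f p) (D (v c))"
    if "e \<in> charts_at B (f p)" for e
    using differential_eq[OF A has_mderiv_compose[OF f has_mderiv_transition[OF B d that]] cd(1) _ v]
      that by (simp add: charts_at_def)
  then have "differential A B f p v e = coord_vector B d (f p) (D (v c)) e" for e
    by (cases "e \<in> charts_at B (f p)") (simp_all only: coord_vector_def differential_def Let_def if_True if_False)
  then have "differential A B f p v = coord_vector B d (f p) (D (v c))" ..
  then show ?thesis using coord_vector(1)[OF B d] by simp
qed

section \<open>Vanishing derivatives and connectedness\<close>

lemma locally_constant_of_derivative_zero:
  fixes h :: "'a::t2_space \<Rightarrow> 'b::real_normed_vector"
    and c :: "('a, 'e::euclidean_space) chart"
  assumes c: "is_chart c" and p: "p \<in> chart_dom c"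
    and h: "\<forall>\<^sub>F q in nhds p. ((h \<circ> chart_inv c) has_derivative (\<lambda>_. 0)) (at (chart_map c q))"
  shows "\<forall>\<^sub>F q in nhds p. h q = h p"
proof -
  have "\<forall>\<^sub>F u in nhds (chart_map c p). ((h \<circ> chart_inv c) has_derivative (\<lambda>_. 0)) (at u)"
    using eventually_chart_inv[OF c p h] eventually_chart_image[OF c p]
    by eventually_elim (simp add: chart_map_inv[OF c])
  then obtain W where "open W" "chart_map c p \<in> W"
    and W: "\<And>u. u \<in> W \<Longrightarrow> ((h \<circ> chart_inv c) has_derivative (\<lambda>_. 0)) (at u)"
    unfolding eventually_nhds by blast
  \<comment> \<open>The argument passes to a ball because it is connected, whereas \<open>W\<close>
    need not be.\<close>
  then obtain r where r: "r > 0" "ball (chart_map c p) r \<subseteq> W"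
    by (auto simp: open_contains_ball)
  have "(h \<circ> chart_inv c) u = (h \<circ> chart_inv c) (chart_map c p)" if "u \<in> ball (chart_map c p) r" for u
    by (rule has_derivative_zero_unique_connected[OF open_ball connected_ball _ that])
       (use r W in \<open>auto simp del: o_apply simp: subset_iff\<close>)
  then have "\<forall>\<^sub>F u in nhds (chart_map c p). h (chart_inv c u) = h p"
    using r p chart_inv_map[OF c p]
    by (auto intro!: eventually_mono[OF eventually_nhds_in_open[of "ball (chart_map c p) r"]])
  from eventually_chart_map[OF c p this] eventually_nhds_in_open[OF open_chart_dom[OF c] p]
  show ?thesis by eventually_elim (simp add: chart_inv_map[OF c])
qed

lemma locally_constant_on_connected:
  assumes "connected S" "open S" "\<And>p. p \<in> S \<Longrightarrow> \<forall>\<^sub>F q in nhds p. f q = f p" "p \<in> S" "q \<in> S"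
  shows "f p = f q"
proof (rule connected_local_const[OF assms(1,4,5)], rule ballI)
  fix a assume "a \<in> S"
  have "\<forall>\<^sub>F b in nhds a. f a = f b" using assms(3)[OF \<open>a \<in> S\<close>] by eventually_elim simp
  then show "\<forall>\<^sub>F b in at a within S. f a = f b" by (simp add: eventually_at_filter eventually_mono)
qed

text \<open>Simple connectedness is defined by free homotopy of loops. A homotopy between two
  constant loops traces a path between their base points.\<close>

lemma simply_connected_imp_connected_topological:
  fixes S :: "'a::topological_space set"
  assumes "simply_connected S"
  shows "connected S"
proof (rule path_connected_imp_connected)
  have "path_component S a b" if "a \<in> S" "b \<in> S" for a b
  proof -
    have "homotopic_loops S (\<lambda>_. a) (\<lambda>_. b)"
      using that by (intro assms[unfolded simply_connected_def, rule_format])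
        (auto simp: path_def pathfinish_def pathstart_def path_image_def)
    from homotopic_loops_imp_path_component_value[OF this, of 0] show ?thesis by simp
  qed
  then show "path_connected S" by (simp add: path_connected_component)
qed

lemma (in group) inv_mult_cancel:
  assumes "x \<in> carrier G" "y \<in> carrier G"
  shows "inv x \<otimes> (x \<otimes> y) = y" "x \<otimes> (inv x \<otimes> y) = y"
  using assms by (simp_all add: m_assoc[symmetric])


section \<open>The adjoint representation\<close>

locale Lie_group = group N for N :: "'a::{t2_space,second_countable_topology} monoid" (structure) +
  fixes A :: "('a, 'e::euclidean_space) chart set"
  assumes lie_group: "lie_group N A"
begin

lemma atlas: "smooth_atlas A" and carrier_eq: "manifold_carrier A = carrier N"
  using lie_group by (simp_all add: lie_group_def)

lemmas chart = is_chart_atlas[OF atlas]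

lemma open_carrier: "open (carrier N)"
  using open_manifold_carrier[OF atlas] by (simp add: carrier_eq)

lemma eventually_carrier: "p \<in> carrier N \<Longrightarrow> \<forall>\<^sub>F q in nhds p. q \<in> carrier N"
  using open_carrier by (rule eventually_nhds_in_open)

lemma chart_dom_carrier: "c \<in> A \<Longrightarrow> p \<in> chart_dom c \<Longrightarrow> p \<in> carrier N"
  using carrier_eq by (auto simp: manifold_carrier_def)

lemma ex_chart: "p \<in> carrier N \<Longrightarrow> \<exists>c. c \<in> A \<and> p \<in> chart_dom c"
  using carrier_eq unfolding manifold_carrier_def by blast

lemma prod_chart_in_prod_atlas:
  "c \<in> A \<Longrightarrow> d \<in> A \<Longrightarrow> prod_chart c d \<in> prod_atlas A A"
  unfolding prod_atlas_def prod_chart_def by blast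

lemma mult_smooth_coordinates:
  assumes "c \<in> A" "d \<in> A" "k \<in> A"
  shows "smooth_on (chart_map (prod_chart c d) `
      (chart_dom (prod_chart c d) \<inter> (\<lambda>(x, y). x \<otimes> y) -` chart_dom k))
    (chart_map k \<circ> (\<lambda>(x, y). x \<otimes> y) \<circ> chart_inv (prod_chart c d))"
  using lie_group prod_chart_in_prod_atlas assms unfolding lie_group_def smooth_map_def by blast

lemma manifold_carrier_prod_atlas: "manifold_carrier (prod_atlas A A) = carrier N \<times> carrier N"
  unfolding carrier_eq[symmetric] manifold_carrier_def prod_atlas_def by force

lemma has_mderiv_mult_map:
  assumes "c \<in> A" "d \<in> A" "k \<in> A" "p \<in> chart_dom c" "q \<in> chart_dom d" "p \<otimes> q \<in> chart_dom k"
  shows "has_mderiv (prod_chart c d) k (\<lambda>(x, y). x \<otimes> y) (p, q)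
    (local_derivative (prod_chart c d) k (\<lambda>(x, y). x \<otimes> y) (p, q))"
proof (rule smooth_map_has_mderiv)
  show "open (manifold_carrier (prod_atlas A A))"
    by (simp add: manifold_carrier_prod_atlas open_Times open_carrier)
  show "smooth_map (prod_atlas A A) A (\<lambda>(x, y). x \<otimes> y)"
    using lie_group by (simp add: lie_group_def)
qed (use assms in \<open>auto intro: prod_chart_in_prod_atlas simp: chart is_chart_prod_chart simp del: prod_chart_simps(3)\<close>)

text \<open>The factors are paired into the product manifold and composed with multiplication. Left
  and right translations are the cases in which one factor is constant.\<close>

lemma has_mderiv_mult:
  assumes f: "has_mderiv b c f p F" and g: "has_mderiv b d g p G"
    and A: "c \<in> A" "d \<in> A" "k \<in> A" "f p \<otimes> g p \<in> chart_dom k"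
  shows "has_mderiv b k (\<lambda>x. f x \<otimes> g x) p
    (\<lambda>v. local_derivative (prod_chart c d) k (\<lambda>(x, y). x \<otimes> y) (f p, g p) (F v, G v))"
  using has_mderiv_compose[OF has_mderiv_Pair[OF f g] has_mderiv_mult_map[OF A(1-3) _ _ A(4)]]
    has_mderivD[OF f] has_mderivD[OF g] by simp

lemma has_mderiv_left_mult:
  assumes "c \<in> A" "k \<in> A" "d \<in> A" "a \<in> chart_dom d" "p \<in> chart_dom c" "a \<otimes> p \<in> chart_dom k"
  shows "has_mderiv c k (\<lambda>x. a \<otimes> x) p
    (\<lambda>v. local_derivative (prod_chart d c) k (\<lambda>(x, y). x \<otimes> y) (a, p) (0, v))"
  using assms by (intro has_mderiv_mult has_mderiv_const has_mderiv_ident chart)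

lemma has_mderiv_right_mult:
  assumes "c \<in> A" "k \<in> A" "d \<in> A" "a \<in> chart_dom d" "p \<in> chart_dom c" "p \<otimes> a \<in> chart_dom k"
  shows "has_mderiv c k (\<lambda>x. x \<otimes> a) p
    (\<lambda>v. local_derivative (prod_chart c d) k (\<lambda>(x, y). x \<otimes> y) (p, a) (v, 0))"
  using assms by (intro has_mderiv_mult has_mderiv_const has_mderiv_ident chart)

lemma has_mderiv_inv:
  assumes "c \<in> A" "k \<in> A" "p \<in> chart_dom c" "inv p \<in> chart_dom k"
  shows "has_mderiv c k (\<lambda>x. inv x) p (local_derivative c k (\<lambda>x. inv x) p)"
  using lie_group assms open_carrier
  by (intro smooth_map_has_mderiv[of A A]) (auto simp: lie_group_def chart)

lemma ex_has_mderiv_left_mult: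
  assumes "c \<in> A" "k \<in> A" "a \<in> carrier N" "p \<in> chart_dom c" "a \<otimes> p \<in> chart_dom k"
  shows "\<exists>D. has_mderiv c k (\<lambda>x. a \<otimes> x) p D"
  using has_mderiv_left_mult ex_chart[OF assms(3)] assms by blast

lemma ex_has_mderiv_right_mult:
  assumes "c \<in> A" "k \<in> A" "a \<in> carrier N" "p \<in> chart_dom c" "p \<otimes> a \<in> chart_dom k"
  shows "\<exists>D. has_mderiv c k (\<lambda>x. x \<otimes> a) p D"
  using has_mderiv_right_mult ex_chart[OF assms(3)] assms by blast

section \<open>Conjugation and the algebraic properties of Ad\<close>

lemma charts_at_one: "c \<in> charts_at A \<one> \<longleftrightarrow> c \<in> A \<and> \<one> \<in> chart_dom c"
  by (simp add: charts_at_def)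

text \<open>Conjugation is a left translation followed by a right one. The intermediate point
  \<open>a\<close> may be far from the identity, so a separate chart \<open>k\<close> around it is
  used in between.\<close>

lemma ex_has_mderiv_conj:
  assumes c: "c \<in> charts_at A \<one>" and d: "d \<in> charts_at A \<one>" and a: "a \<in> carrier N"
  shows "\<exists>D. has_mderiv c d (\<lambda>x. a \<otimes> x \<otimes> inv a) \<one> D"
proof -
  obtain k where k: "k \<in> A" "a \<in> chart_dom k" using ex_chart[OF a] by blast
  obtain D where "has_mderiv c k (\<lambda>x. a \<otimes> x) \<one> D"
    using ex_has_mderiv_left_mult[of c k a \<one>] c k a by (auto simp: charts_at_one)
  moreover obtain E where "has_mderiv k d (\<lambda>x. x \<otimes> inv a) (a \<otimes> \<one>) E"
    using ex_has_mderiv_right_mult[of k d "inv a" a] d k a by (auto simp: charts_at_one)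
  ultimately have "has_mderiv c d (\<lambda>x. a \<otimes> x \<otimes> inv a) \<one> (\<lambda>v. E (D v))"
    by (rule has_mderiv_compose)
  then show ?thesis by (intro exI[of _ "\<lambda>v. E (D v)"])
qed

lemma Ad_eq:
  assumes "has_mderiv c d (\<lambda>x. a \<otimes> x \<otimes> inv a) \<one> D" "c \<in> A" "d \<in> A" "x \<in> lie_algebra N A"
  shows "Ad N A a x d = D (x c)"
  using differential_eq[OF atlas assms(1-3)] assms(4) by (simp add: Ad_def lie_algebra_def)

lemma ex_chart_one: obtains c where "c \<in> charts_at A \<one>"
  using ex_chart[OF one_closed] by (auto simp: charts_at_def)

lemma Ad_closed:
  assumes "a \<in> carrier N" "x \<in> lie_algebra N A"
  shows "Ad N A a x \<in> lie_algebra N A"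
proof -
  obtain c where c: "c \<in> charts_at A \<one>" by (rule ex_chart_one)
  obtain D where "has_mderiv c c (\<lambda>x. a \<otimes> x \<otimes> inv a) \<one> D" using ex_has_mderiv_conj[OF c c assms(1)] ..
  from differential_tangent_space[OF atlas atlas this] c assms show ?thesis
    by (simp add: Ad_def lie_algebra_def charts_at_one)
qed

lemma lie_algebra_add_diff:
  assumes "x \<in> lie_algebra N A" "y \<in> lie_algebra N A"
  shows "x + y \<in> lie_algebra N A" "x - y \<in> lie_algebra N A"
  using assms tangent_space_add_diff[OF atlas] by (auto simp: lie_algebra_def)

lemma lie_algebra_eqI:
  "x \<in> lie_algebra N A \<Longrightarrow> y \<in> lie_algebra N A \<Longrightarrow> c \<in> charts_at A \<one> \<Longrightarrow> x c = y c \<Longrightarrow> x = y"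
  unfolding lie_algebra_def by (rule tangent_space_eqI[OF atlas])

text \<open>This is the chain rule for conjugation by \<open>b\<close> followed by conjugation by
  \<open>a\<close>. The rearrangement into conjugation by the product holds on the carrier, a
  neighbourhood of the identity.\<close>

lemma Ad_mult:
  assumes a: "a \<in> carrier N" and b: "b \<in> carrier N" and x: "x \<in> lie_algebra N A"
  shows "Ad N A (a \<otimes> b) x = Ad N A a (Ad N A b x)"
proof -
  obtain c where c: "c \<in> charts_at A \<one>" by (rule ex_chart_one)
  note cA = c[unfolded charts_at_one, THEN conjunct1]
  obtain D where D: "has_mderiv c c (\<lambda>x. a \<otimes> x \<otimes> inv a) \<one> D" using ex_has_mderiv_conj[OF c c a] ..
  obtain E where E: "has_mderiv c c (\<lambda>x. b \<otimes> x \<otimes> inv b) \<one> E" using ex_has_mderiv_conj[OF c c b] ..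
  have "has_mderiv c c (\<lambda>x. a \<otimes> (b \<otimes> x \<otimes> inv b) \<otimes> inv a) \<one> (\<lambda>v. D (E v))"
    by (rule has_mderiv_compose[OF E]) (use D b in simp)
  then have "has_mderiv c c (\<lambda>x. (a \<otimes> b) \<otimes> x \<otimes> inv (a \<otimes> b)) \<one> (\<lambda>v. D (E v))"
    by (rule has_mderiv_cong)
       (use eventually_carrier[OF one_closed] a b in
         \<open>auto elim!: eventually_mono simp: m_assoc inv_mult_group\<close>)
  from Ad_eq[OF this cA cA x] Ad_eq[OF E cA cA x] Ad_eq[OF D cA cA Ad_closed[OF b x]]
  show ?thesis
    using a b x c by (intro lie_algebra_eqI[of _ _ c] Ad_closed) auto
qed

lemma Ad_one: "x \<in> lie_algebra N A \<Longrightarrow> Ad N A \<one> x = x"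
proof -
  assume x: "x \<in> lie_algebra N A"
  obtain c where c: "c \<in> charts_at A \<one>" by (rule ex_chart_one)
  have "has_mderiv c c (\<lambda>x. \<one> \<otimes> x \<otimes> inv \<one>) \<one> (\<lambda>v. v)"
    by (rule has_mderiv_cong[OF has_mderiv_ident])
       (use c eventually_carrier[OF one_closed] in \<open>auto elim!: eventually_mono simp: charts_at_one chart\<close>)
  from Ad_eq[OF this _ _ x] show ?thesis
    using x c by (intro lie_algebra_eqI[of _ _ c] Ad_closed) (auto simp: charts_at_one)
qed

lemma Ad_add:
  assumes "a \<in> carrier N" "x \<in> lie_algebra N A" "y \<in> lie_algebra N A"
  shows "Ad N A a (x + y) = Ad N A a x + Ad N A a y"
proof -
  obtain c where c: "c \<in> charts_at A \<one>" by (rule ex_chart_one)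
  note cA = c[unfolded charts_at_one, THEN conjunct1]
  obtain D where D: "has_mderiv c c (\<lambda>x. a \<otimes> x \<otimes> inv a) \<one> D" using ex_has_mderiv_conj[OF c c assms(1)] ..
  have "Ad N A a (x + y) c = (Ad N A a x + Ad N A a y) c"
    using assms lie_algebra_add_diff(1)[OF assms(2,3)] linear_add[OF has_mderiv_linear[OF D]]
    by (simp add: Ad_eq[OF D cA cA])
  then show ?thesis using assms c by (intro lie_algebra_eqI[of _ _ c] Ad_closed lie_algebra_add_diff)
qed

lemma ex_lie_algebra_coord:
  assumes "c \<in> charts_at A \<one>"
  obtains x where "x \<in> lie_algebra N A" "x c = w"
  using coord_vector[OF atlas assms] by (auto simp: lie_algebra_def)

text \<open>Multiplication restricts to the identity map on each factor when the other is
  \<open>\<one>\<close>. By linearity its derivative at the pair of identities is addition.\<close>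

lemma has_mderiv_mult_at_one:
  assumes f: "has_mderiv b c f p F" and g: "has_mderiv b c g p G"
    and c: "c \<in> charts_at A \<one>" and "f p = \<one>" "g p = \<one>"
  shows "has_mderiv b c (\<lambda>x. f x \<otimes> g x) p (\<lambda>v. F v + G v)"
proof -
  note c' = c[unfolded charts_at_one] chart[OF c[unfolded charts_at_one, THEN conjunct1]]
  define M where "M = local_derivative (prod_chart c c) c (\<lambda>(x, y). x \<otimes> y) (\<one>, \<one>)"
  have M: "linear M"
    using has_mderiv_mult_map[of c c c \<one> \<one>] c' by (auto simp: M_def dest: has_mderiv_linear)
  have id: "has_mderiv c c (\<lambda>x. x) \<one> (\<lambda>v. v)" and const: "has_mderiv c c (\<lambda>x. \<one>) \<one> (\<lambda>_. 0)"
    using c' by (auto intro: has_mderiv_ident has_mderiv_const)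
  have "has_mderiv c c (\<lambda>x. x) \<one> (\<lambda>v. M (v, 0))"
    by (rule has_mderiv_cong[OF has_mderiv_mult[OF id const, of c, folded M_def]])
       (use c' eventually_carrier[OF one_closed] in \<open>auto elim!: eventually_mono\<close>)
  then have "(\<lambda>v. M (v, 0)) = (\<lambda>v. v)" using id by (rule has_mderiv_unique)
  moreover have "has_mderiv c c (\<lambda>x. x) \<one> (\<lambda>v. M (0, v))"
    by (rule has_mderiv_cong[OF has_mderiv_mult[OF const id, of c, folded M_def]])
       (use c' eventually_carrier[OF one_closed] in \<open>auto elim!: eventually_mono\<close>)
  then have "(\<lambda>v. M (0, v)) = (\<lambda>v. v)" using id by (rule has_mderiv_unique)
  ultimately have "M (v, w) = v + w" for v w
    using linear_add[OF M, of "(v, 0)" "(0, w)"] by (metis add_Pair add.right_neutral add.left_neutral)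
  then show ?thesis
    using has_mderiv_mult[OF f g, of c] assms c' by (simp add: M_def)
qed

text \<open>
  In a chart at the identity let \<open>P\<close> be the multiplication, \<open>Q\<close> its derivative and \<open>M\<close> its second
  derivative at the identity.  Left multiplication by \<open>a\<close> is conjugation by \<open>a\<close> followed by right
  multiplication by \<open>a\<close>, that is \<open>Q (u, e) (0, y) = Q (e, u) (Ad(u) y, 0)\<close>.  Differentiating this
  in \<open>u\<close> expresses the derivative of \<open>Ad(u) y\<close> by mixed second derivatives of \<open>P\<close>, whose symmetry
  identifies it with the bracket.
\<close>

lemma Ad_derivative_at_one:
  assumes c: "c \<in> charts_at A \<one>" and y: "y \<in> lie_algebra N A"
  obtains G where
    "((\<lambda>u. Ad N A (chart_inv c u) y c) has_derivative G) (at (chart_map c \<one>))"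
    "\<And>x. x \<in> lie_algebra N A \<Longrightarrow> lie_bracket N A x y c = G (x c)"
proof -
  define U where "U = chart_map c ` chart_dom c"
  define e where "e = chart_map c \<one>"
  define P where "P = chart_map c \<circ> (\<lambda>(x, y). x \<otimes> y) \<circ> chart_inv (prod_chart c c)"
  \<comment> \<open>Coordinates of a product make sense only while the product stays in the domain
    of \<open>c\<close>. \<open>W\<close> collects these pairs; \<open>S\<close> is their image in
    coordinates, on which \<open>P\<close> is smooth.\<close>
  define W where "W = chart_dom (prod_chart c c) \<inter> (\<lambda>(x, y). x \<otimes> y) -` chart_dom c"
  define S where "S = chart_map (prod_chart c c) ` W"
  define Q where "Q z = frechet_derivative P (at z)" for z
  define M where "M v = frechet_derivative (\<lambda>z. Q z v) (at (e, e))" for v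
  have cA: "c \<in> A" and c1: "\<one> \<in> chart_dom c" and ch: "is_chart c" and ch2: "is_chart (prod_chart c c)"
    using c by (auto simp: charts_at_one intro!: chart is_chart_prod_chart)
  note car = chart_dom_carrier[OF cA]
  note invmap [simp] = chart_inv_map[OF ch]
  have smooth: "smooth_on S P"
    unfolding S_def P_def W_def by (rule mult_smooth_coordinates[OF cA cA cA])
  have Qeq: "local_derivative (prod_chart c c) c (\<lambda>(x, y). x \<otimes> y) (p, q) = Q (chart_map c p, chart_map c q)"
    for p q by (simp add: Q_def P_def local_derivative_def)
  have S_iff: "(chart_map c p, chart_map c q) \<in> S" if "p \<in> chart_dom c" "q \<in> chart_dom c" "p \<otimes> q \<in> chart_dom c" for p q
    unfolding S_def W_def using that by (intro image_eqI[of _ _ "(p, q)"]) auto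
  have eS: "(e, e) \<in> S" using S_iff[of \<one> \<one>] c1 by (simp add: e_def)
  have Qlin: "linear (Q z)" if "z \<in> S" for z
    using smooth_on_differentiable[OF smooth that]
    by (simp add: Q_def frechet_derivative_works has_derivative_linear)
  have M: "((\<lambda>z. Q z v) has_derivative M v) (at (e, e))" for v
    using smooth_on_frechet_derivative_differentiable[OF smooth eS, of v]
    by (simp add: M_def Q_def frechet_derivative_works)
  have M_comp: "((\<lambda>u. Q (f u) v) has_derivative (\<lambda>h. M v (f' h))) (at e)"
    if "(f has_derivative f') (at e)" "f e = (e, e)" for f f' v
    using has_derivative_compose[OF that(1), of "\<lambda>z. Q z v" "M v"] M[of v] that(2) by simp
  have ev_one: "\<forall>\<^sub>F u in nhds e. R (chart_inv c u)" if "\<forall>\<^sub>F q in nhds \<one>. R q" for R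
    unfolding e_def by (rule eventually_chart_inv[OF ch c1 that])
  have ev_dom: "\<forall>\<^sub>F q in nhds \<one>. q \<in> chart_dom c"
    by (rule eventually_nhds_in_open[OF open_chart_dom[OF ch] c1])
  have evU: "\<forall>\<^sub>F u in nhds e. u \<in> U"
    unfolding e_def U_def by (rule eventually_chart_image[OF ch c1])
  have U: "chart_inv c u \<in> chart_dom c" "chart_map c (chart_inv c u) = u" if "u \<in> U" for u
    using that chart_inv_in_dom[OF ch] chart_map_inv[OF ch] by (simp_all add: U_def)
  have mixed: "M (w, 0) (0, v) = M (0, v) (w, 0)" for v w
  proof (rule symmetric_second_derivative[OF _ _ _ M M])
    have "open W"
    proof -
      have "continuous_on (carrier N \<times> carrier N) (\<lambda>(x, y). x \<otimes> y)"
        using lie_group unfolding lie_group_def smooth_map_def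
        by (metis (no_types, lifting) manifold_carrier_prod_atlas)
      then have "continuous_on (chart_dom (prod_chart c c)) (\<lambda>(x, y). x \<otimes> y)"
        by (rule continuous_on_subset) (use car in auto)
      then show ?thesis
        unfolding W_def by (rule continuous_open_preimage[OF _ open_chart_dom[OF ch2] open_chart_dom[OF ch]])
    qed
    then show "open S"
      unfolding S_def by (rule open_chart_image_of_open[OF ch2]) (simp add: W_def)
    show "(P has_derivative Q z) (at z)" if "z \<in> S" for z
      using smooth_on_differentiable[OF smooth that] by (simp add: Q_def frechet_derivative_works)
  qed (rule eS)
  have Q_left: "Q (e, e) (w, 0) = w" and Q_right: "Q (e, e) (0, w) = w" for w
  proof -
    have id: "has_mderiv c c (\<lambda>x. x) \<one> (\<lambda>v. v)" by (rule has_mderiv_ident[OF ch c1])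
    have "has_mderiv c c (\<lambda>x. x) \<one> (\<lambda>v. Q (e, e) (v, 0))"
      by (rule has_mderiv_cong[OF has_mderiv_right_mult[of c c c \<one> \<one>, unfolded Qeq, folded e_def]])
         (use cA c1 eventually_carrier[OF one_closed] in \<open>auto elim!: eventually_mono\<close>)
    from has_mderiv_unique[OF this id] show "Q (e, e) (w, 0) = w" by (rule fun_cong)
    have "has_mderiv c c (\<lambda>x. x) \<one> (\<lambda>v. Q (e, e) (0, v))"
      by (rule has_mderiv_cong[OF has_mderiv_left_mult[of c c c \<one> \<one>, unfolded Qeq, folded e_def]])
         (use cA c1 eventually_carrier[OF one_closed] in \<open>auto elim!: eventually_mono\<close>)
    from has_mderiv_unique[OF this id] show "Q (e, e) (0, w) = w" by (rule fun_cong)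
  qed
  have left: "has_mderiv c c (\<lambda>x. a \<otimes> x) \<one> (\<lambda>v. Q (chart_map c a, e) (0, v))" if "a \<in> chart_dom c" for a
    using has_mderiv_left_mult[of c c c a \<one>] that cA c1 car[OF that] by (simp add: Qeq e_def)
  have field: "left_invariant_field N A x a c = Q (chart_map c a, e) (0, x c)"
    if "a \<in> chart_dom c" "x \<in> lie_algebra N A" for a x
    using differential_eq[OF atlas left[OF that(1)] cA cA] that
    by (simp add: left_invariant_field_def lie_algebra_def)
  \<comment> \<open>This is inversion in coordinates. The predicate \<open>near\<close> singles out
    those \<open>u\<close> whose inverse also lies in the chart, so that right translation by the
    inverse can be expressed through \<open>Q\<close>.\<close>
  define i where "i u = chart_map c (inv (chart_inv c u))" for u
  define near where "near u \<longleftrightarrow> u \<in> U \<and> inv (chart_inv c u) \<in> chart_dom c" for u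
  obtain i' where i': "has_mderiv c c (\<lambda>x. inv x) \<one> i'"
    using has_mderiv_inv[of c c \<one>] cA c1 by auto
  then have i: "(i has_derivative i') (at e)"
    by (simp add: i_def[abs_def] has_mderiv_def o_def e_def)
  have near: "\<forall>\<^sub>F u in nhds e. near u"
    unfolding near_def using evU ev_one[OF has_mderiv_eventually_dom[OF i']]
    by (rule eventually_conj)
  have i_e: "i e = e" using c1 by (simp add: i_def e_def)
  have inS: "(u, e) \<in> S \<and> (e, u) \<in> S" if "u \<in> U" for u
    using S_iff[of "chart_inv c u" \<one>] S_iff[of \<one> "chart_inv c u"] U[OF that] c1 car by (simp add: e_def)
  have inS': "(u, i u) \<in> S" if "near u" for u
    using S_iff[of "chart_inv c u" "inv (chart_inv c u)"] that U[of u] c1 car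
    by (simp add: near_def i_def)
  define Y where "Y u = Ad N A (chart_inv c u) y c" for u
  \<comment> \<open>This explicit formula serves to show that \<open>Y\<close> is differentiable.
    The value of the derivative is read off from \<open>Y_rel\<close> instead, where inversion does
    not occur.\<close>
  have Y_eq: "Y u = Q (u, i u) (Q (u, e) (0, y c), 0)" if "near u" for u
  proof -
    define a where "a = chart_inv c u"
    have a: "a \<in> chart_dom c" "inv a \<in> chart_dom c" "chart_map c a = u" "chart_map c (inv a) = i u"
      using that U[of u] by (auto simp: near_def a_def i_def)
    have "has_mderiv c c (\<lambda>x. x \<otimes> inv a) (a \<otimes> \<one>) (\<lambda>v. Q (u, i u) (v, 0))"
      using has_mderiv_right_mult[of c c c "inv a" a] a cA c1 car by (simp add: Qeq)
    from Ad_eq[OF has_mderiv_compose[OF left[OF a(1)] this] cA cA y] show ?thesis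
      by (simp add: Y_def a_def[symmetric] a)
  qed
  have Y_rel: "Q (e, u) (Y u, 0) = Q (u, e) (0, y c)" if "u \<in> U" for u
  proof -
    define a where "a = chart_inv c u"
    have a: "a \<in> chart_dom c" "a \<in> carrier N" "chart_map c a = u"
      using U[OF that] car by (auto simp: a_def)
    obtain D where D: "has_mderiv c c (\<lambda>x. a \<otimes> x \<otimes> inv a) \<one> D"
      using ex_has_mderiv_conj[OF c c a(2)] ..
    have "has_mderiv c c (\<lambda>x. x \<otimes> a) (a \<otimes> \<one> \<otimes> inv a) (\<lambda>v. Q (e, u) (v, 0))"
      using has_mderiv_right_mult[of c c c a \<one>] a cA c1 by (simp add: Qeq e_def)
    from has_mderiv_compose[OF D this]
    have "has_mderiv c c (\<lambda>x. a \<otimes> x \<otimes> inv a \<otimes> a) \<one> (\<lambda>v. Q (e, u) (D v, 0))" .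
    then have "has_mderiv c c (\<lambda>x. a \<otimes> x) \<one> (\<lambda>v. Q (e, u) (D v, 0))"
      by (rule has_mderiv_cong)
         (use eventually_carrier[OF one_closed] a in \<open>auto elim!: eventually_mono simp: m_assoc\<close>)
    from has_mderiv_unique[OF this left[OF a(1)]] have "Q (e, u) (D (y c), 0) = Q (u, e) (0, y c)"
      using a by (simp add: fun_eq_iff)
    then show ?thesis using Ad_eq[OF D cA cA y] by (simp add: Y_def a_def)
  qed
  have right_d: "((\<lambda>u. Q (u, e) (0, v)) has_derivative (\<lambda>h. M (0, v) (h, 0))) (at e)" for v
    by (rule M_comp) (auto intro!: derivative_eq_intros)
  have "((\<lambda>u. Q (u, i u) (Q (u, e) (0, y c), 0)) has_derivative
      (\<lambda>h. Q (e, i e) (M (0, y c) (h, 0), 0) + M (Q (e, e) (0, y c), 0) (h, i' h))) (at e)"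
  proof (rule has_derivative_linear_apply[where L = "\<lambda>u v. Q (u, i u) (v, 0)"])
    show "\<forall>\<^sub>F u in nhds e. linear (\<lambda>v. Q (u, i u) (v, 0))"
      using near
    proof eventually_elim
      case (elim u)
      have "linear (\<lambda>v. (v, 0))" by (rule linearI) auto
      from linear_compose[OF this Qlin[OF inS'[OF elim]]] show ?case by (simp add: o_def)
    qed
    show "((\<lambda>u. Q (u, i u) (v, 0)) has_derivative (\<lambda>h. M (v, 0) (h, i' h))) (at e)" for v
      by (rule M_comp) (auto intro!: derivative_eq_intros i simp: i_e)
  qed (rule right_d)
  then have "(Y has_derivative
      (\<lambda>h. Q (e, i e) (M (0, y c) (h, 0), 0) + M (Q (e, e) (0, y c), 0) (h, i' h))) (at e)"
    by (rule has_derivative_transform_nhds) (use near in \<open>auto elim!: eventually_mono simp: Y_eq\<close>)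
  then obtain Y' where Y': "(Y has_derivative Y') (at e)" by blast
  have Y_e: "Y e = y c" using Ad_one[OF y] c1 by (simp add: Y_def e_def)
  have "((\<lambda>u. Q (e, u) (Y u, 0)) has_derivative
      (\<lambda>h. Q (e, e) (Y' h, 0) + M (Y e, 0) (0, h))) (at e)"
  proof (rule has_derivative_linear_apply[where L = "\<lambda>u v. Q (e, u) (v, 0)"])
    show "\<forall>\<^sub>F u in nhds e. linear (\<lambda>v. Q (e, u) (v, 0))"
      using evU
    proof eventually_elim
      case (elim u)
      have "linear (\<lambda>v. (v, 0))" by (rule linearI) auto
      from linear_compose[OF this Qlin[of "(e, u)"]] inS[OF elim] show ?case by (simp add: o_def)
    qed
    show "((\<lambda>u. Q (e, u) (v, 0)) has_derivative (\<lambda>h. M (v, 0) (0, h))) (at e)" for v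
      by (rule M_comp) (auto intro!: derivative_eq_intros)
  qed (rule Y')
  then have "((\<lambda>u. Q (u, e) (0, y c)) has_derivative
      (\<lambda>h. Q (e, e) (Y' h, 0) + M (Y e, 0) (0, h))) (at e)"
    by (rule has_derivative_transform_nhds) (use evU in \<open>auto elim!: eventually_mono simp: Y_rel\<close>)
  from fun_cong[OF has_derivative_unique[OF this right_d]]
  have Y'_eq: "Y' h = M (0, y c) (h, 0) - M (y c, 0) (0, h)" for h
    by (simp add: Q_left Y_e eq_diff_eq)
  show thesis
  proof (rule that)
    show "((\<lambda>u. Ad N A (chart_inv c u) y c) has_derivative Y') (at (chart_map c \<one>))"
      using Y' by (simp add: Y_def[abs_def] e_def)
    fix x assume x: "x \<in> lie_algebra N A"
    have fd: "frechet_derivative (\<lambda>u. left_invariant_field N A z (chart_inv c u) c) (at e) =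
        (\<lambda>h. M (0, z c) (h, 0))" if "z \<in> lie_algebra N A" for z
    proof (rule frechet_derivative_at[symmetric])
      show "((\<lambda>u. left_invariant_field N A z (chart_inv c u) c) has_derivative
          (\<lambda>h. M (0, z c) (h, 0))) (at e)"
        by (rule has_derivative_transform_nhds[OF right_d eventually_mono[OF evU]])
           (simp add: field U that)
    qed
    have "left_invariant_field N A z \<one> c = z c" if "z \<in> lie_algebra N A" for z
      using field[OF c1 that] by (simp add: Q_right e_def[symmetric])
    then have "lie_bracket N A x y c = M (0, y c) (x c, 0) - M (0, x c) (y c, 0)"
      using c x y by (simp add: lie_bracket_def vector_field_bracket_def e_def[symmetric] fd)
    \<comment> \<open>The identity \<open>mixed\<close> replaces \<open>M (y c, 0) (0, x c)\<close>
      by \<open>M (0, x c) (y c, 0)\<close>.\<close>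
    then show "lie_bracket N A x y c = Y' (x c)" by (simp add: Y'_eq mixed)
  qed
qed

section \<open>The bracket and the derivative of Ad at arbitrary points\<close>

lemma lie_bracket_skew: "lie_bracket N A x y = - lie_bracket N A y x"
  by (auto simp: lie_bracket_def vector_field_bracket_def fun_eq_iff)

text \<open>The bracket is the derivative of \<open>Ad(a) y\<close> in \<open>a\<close>, and this
  vector always lies in the Lie algebra. Its coordinates in \<open>c\<close> and \<open>d\<close>
  are thus related by the fixed linear map \<open>T\<close>, so the chain rule gives the
  transformation law without second derivatives of transition maps.\<close>

lemma lie_bracket_closed:
  assumes x: "x \<in> lie_algebra N A" and y: "y \<in> lie_algebra N A"
  shows "lie_bracket N A x y \<in> lie_algebra N A"
proof -
  have "lie_bracket N A x y d = local_derivative c d id \<one> (lie_bracket N A x y c)"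
    if c: "c \<in> charts_at A \<one>" and d: "d \<in> charts_at A \<one>" for c d
  proof -
    define T where "T = local_derivative c d id \<one>"
    define S where "S = local_derivative d c id \<one>"
    have T: "has_mderiv c d (\<lambda>x. x) \<one> T"
      using has_mderiv_transition[OF atlas c d] by (simp add: T_def)
    have S: "has_mderiv d c (\<lambda>x. x) \<one> S"
      using has_mderiv_transition[OF atlas d c] by (simp add: S_def)
    note T' = has_mderivD[OF T] and S' = has_mderivD[OF S]
    have transform: "z d = T (z c)" "z c = S (z d)" if "z \<in> lie_algebra N A" for z
      unfolding T_def S_def using that c d
      by (auto intro: tangent_space_transform[OF atlas] simp only: lie_algebra_def)
    obtain G where G: "((\<lambda>u. Ad N A (chart_inv c u) y c) has_derivative G) (at (chart_map c \<one>))"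
      and G_bracket: "\<And>x. x \<in> lie_algebra N A \<Longrightarrow> lie_bracket N A x y c = G (x c)"
      using Ad_derivative_at_one[OF c y] by blast
    obtain H where H: "((\<lambda>u. Ad N A (chart_inv d u) y d) has_derivative H) (at (chart_map d \<one>))"
      and H_bracket: "\<And>x. x \<in> lie_algebra N A \<Longrightarrow> lie_bracket N A x y d = H (x d)"
      using Ad_derivative_at_one[OF d y] by blast
    have inner: "((\<lambda>u. Ad N A (chart_inv c ((chart_map c \<circ> (\<lambda>x. x) \<circ> chart_inv d) u)) y c)
        has_derivative (\<lambda>h. G (S h))) (at (chart_map d \<one>))"
      by (rule has_derivative_compose[OF S'(6), of "\<lambda>u. Ad N A (chart_inv c u) y c"])
         (use G S' in \<open>simp add: chart_inv_map\<close>)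
    have "((\<lambda>u. T (Ad N A (chart_inv c ((chart_map c \<circ> (\<lambda>x. x) \<circ> chart_inv d) u)) y c))
        has_derivative (\<lambda>h. T (G (S h)))) (at (chart_map d \<one>))"
      by (rule bounded_linear.has_derivative[OF has_mderiv_bounded_linear[OF T] inner])
    then have "((\<lambda>u. Ad N A (chart_inv d u) y d) has_derivative (\<lambda>h. T (G (S h)))) (at (chart_map d \<one>))"
    proof (rule has_derivative_transform_nhds)
      have "\<forall>\<^sub>F q in nhds \<one>. q \<in> chart_dom c"
        by (rule eventually_nhds_in_open[OF open_chart_dom[OF T'(1)] T'(3)])
      from eventually_chart_inv[OF S'(1,3) this]
      show "\<forall>\<^sub>F u in nhds (chart_map d \<one>).
          T (Ad N A (chart_inv c ((chart_map c \<circ> (\<lambda>x. x) \<circ> chart_inv d) u)) y c) =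
          Ad N A (chart_inv d u) y d"
      proof eventually_elim
        case (elim u)
        then have "chart_inv d u \<in> carrier N" using c by (auto simp: charts_at_def intro: chart_dom_carrier)
        then show ?case using elim T'(1) transform(1)[OF Ad_closed[OF _ y]] by (simp add: chart_inv_map)
      qed
    qed
    from has_derivative_unique[OF H this] show ?thesis
      unfolding T_def[symmetric] H_bracket[OF x] G_bracket[OF x] transform(2)[OF x] by (rule fun_cong)
  qed
  moreover have "lie_bracket N A x y c = 0" if "c \<notin> charts_at A \<one>" for c
    using that by (simp only: lie_bracket_def vector_field_bracket_def if_False)
  ultimately show ?thesis unfolding lie_algebra_def tangent_space_def by blast
qed

text \<open>Writing \<open>q\<close> as \<open>p \<otimes> (inv p \<otimes> q)\<close>,
  multiplicativity of \<open>Ad\<close> reduces to the derivative at the identity. The vector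
  \<open>x\<close> depends on \<open>h\<close>: its coordinates are the image of \<open>h\<close>
  under the derivative of left translation by \<open>inv p\<close>.\<close>

lemma Ad_derivative:
  assumes p: "p \<in> carrier N" and d: "d \<in> A" "p \<in> chart_dom d"
    and c: "c \<in> charts_at A \<one>" and y: "y \<in> lie_algebra N A"
  obtains F where
    "((\<lambda>u. Ad N A (chart_inv d u) y c) has_derivative F) (at (chart_map d p))"
    "\<And>h. \<exists>x\<in>lie_algebra N A. F h = Ad N A p (lie_bracket N A x y) c"
proof -
  have cA: "c \<in> A" and c1: "\<one> \<in> chart_dom c" using c by (auto simp: charts_at_one)
  obtain H where H: "has_mderiv d c (\<lambda>q. inv p \<otimes> q) p H"
    using ex_has_mderiv_left_mult[of d c "inv p" p] p d cA c1 by auto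
  note H' = has_mderivD[OF H]
  obtain D where D: "has_mderiv c c (\<lambda>x. p \<otimes> x \<otimes> inv p) \<one> D" using ex_has_mderiv_conj[OF c c p] ..
  obtain G where G: "((\<lambda>u. Ad N A (chart_inv c u) y c) has_derivative G) (at (chart_map c \<one>))"
    and G_bracket: "\<And>x. x \<in> lie_algebra N A \<Longrightarrow> lie_bracket N A x y c = G (x c)"
    using Ad_derivative_at_one[OF c y] by blast
  have inner: "((\<lambda>u. Ad N A (chart_inv c ((chart_map c \<circ> (\<lambda>q. inv p \<otimes> q) \<circ> chart_inv d) u)) y c)
        has_derivative (\<lambda>h. G (H h))) (at (chart_map d p))"
      by (rule has_derivative_compose[OF H'(6), of "\<lambda>u. Ad N A (chart_inv c u) y c"])
         (use G H' p in \<open>simp add: chart_inv_map\<close>)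
  have "((\<lambda>u. D (Ad N A (chart_inv c ((chart_map c \<circ> (\<lambda>q. inv p \<otimes> q) \<circ> chart_inv d) u)) y c))
        has_derivative (\<lambda>h. D (G (H h)))) (at (chart_map d p))"
      by (rule bounded_linear.has_derivative[OF has_mderiv_bounded_linear[OF D] inner])
  then have "((\<lambda>u. Ad N A (chart_inv d u) y c) has_derivative (\<lambda>h. D (G (H h)))) (at (chart_map d p))"
  proof (rule has_derivative_transform_nhds)
    show "\<forall>\<^sub>F u in nhds (chart_map d p).
        D (Ad N A (chart_inv c ((chart_map c \<circ> (\<lambda>q. inv p \<otimes> q) \<circ> chart_inv d) u)) y c) =
        Ad N A (chart_inv d u) y c"
      using eventually_chart_inv[OF H'(1,3) has_mderiv_eventually_dom[OF H]]
        eventually_chart_inv[OF H'(1,3) eventually_carrier[OF p]]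
    proof eventually_elim
      case (elim u)
      define q where "q = chart_inv d u"
      have q: "q \<in> carrier N" "inv p \<otimes> q \<in> chart_dom c" using elim by (simp_all add: q_def)
      have "Ad N A q y = Ad N A p (Ad N A (inv p \<otimes> q) y)"
        using Ad_mult[OF p, of "inv p \<otimes> q"] p q y by (simp add: m_assoc[symmetric])
      then have "Ad N A q y c = D (Ad N A (inv p \<otimes> q) y c)"
        using Ad_eq[OF D cA cA Ad_closed[OF _ y]] p q by simp
      then show ?case using q H'(2) by (simp add: q_def[symmetric] chart_inv_map)
    qed
  qed
  moreover have "\<exists>x\<in>lie_algebra N A. D (G (H h)) = Ad N A p (lie_bracket N A x y) c" for h
  proof -
    obtain x where x: "x \<in> lie_algebra N A" "x c = H h" using ex_lie_algebra_coord[OF c] by blast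
    then show ?thesis
      using Ad_eq[OF D cA cA lie_bracket_closed[OF x(1) y]] G_bracket[OF x(1)]
      by (intro bexI[OF _ x(1)]) simp
  qed
  ultimately show thesis by (rule that)
qed

text \<open>By \<open>Ad_derivative\<close>, the assumption on \<open>\<xi>\<close> says that the
  real function \<open>Ad(a) y\<close> paired with \<open>\<xi>\<close> has zero derivative on the
  connected carrier. The scalar form serves two uses: every \<open>\<xi>\<close> for central
  \<open>y\<close>, and \<open>\<xi>\<close> orthogonal to the center for general
  \<open>y\<close>.\<close>

lemma Ad_inner_constant:
  assumes conn: "connected (carrier N)"
    and c: "c \<in> charts_at A \<one>" and y: "y \<in> lie_algebra N A"
    and orth: "\<And>x p. x \<in> lie_algebra N A \<Longrightarrow> p \<in> carrier N \<Longrightarrow>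
      Ad N A p (lie_bracket N A x y) c \<bullet> \<xi> = 0"
    and a: "a \<in> carrier N"
  shows "Ad N A a y c \<bullet> \<xi> = y c \<bullet> \<xi>"
proof -
  have "Ad N A a y c \<bullet> \<xi> = Ad N A \<one> y c \<bullet> \<xi>"
  proof (rule locally_constant_on_connected[OF conn open_carrier _ a one_closed])
    fix p assume p: "p \<in> carrier N"
    then obtain d where d: "d \<in> A" "p \<in> chart_dom d" using ex_chart by blast
    show "\<forall>\<^sub>F q in nhds p. Ad N A q y c \<bullet> \<xi> = Ad N A p y c \<bullet> \<xi>"
    proof (rule locally_constant_of_derivative_zero[OF chart[OF d(1)] d(2)])
      show "\<forall>\<^sub>F q in nhds p. (((\<lambda>q. Ad N A q y c \<bullet> \<xi>) \<circ> chart_inv d) has_derivative (\<lambda>_. 0))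
          (at (chart_map d q))"
        using eventually_nhds_in_open[OF open_chart_dom[OF chart[OF d(1)]] d(2)]
      proof eventually_elim
        case (elim q)
        have q: "q \<in> carrier N" using chart_dom_carrier[OF d(1) elim] .
        obtain F where F: "((\<lambda>u. Ad N A (chart_inv d u) y c) has_derivative F) (at (chart_map d q))"
          "\<And>h. \<exists>x\<in>lie_algebra N A. F h = Ad N A q (lie_bracket N A x y) c"
          using Ad_derivative[OF q d(1) elim c y] by blast
        have "F h \<bullet> \<xi> = 0" for h using F(2)[of h] orth q by auto
        with has_derivative_inner_left[OF F(1), of \<xi>] show ?case by (simp add: o_def)
      qed
    qed
  qed
  then show ?thesis using Ad_one[OF y] by simp
qed

section \<open>Ad on the center and modulo the center\<close>

lemma lie_algebra_zero: "0 \<in> lie_algebra N A"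
proof -
  obtain c where c: "c \<in> charts_at A \<one>" by (rule ex_chart_one)
  obtain x where "x \<in> lie_algebra N A" using ex_lie_algebra_coord[OF c] by blast
  from lie_algebra_add_diff(2)[OF this this] show ?thesis by simp
qed

lemma Ad_zero: "a \<in> carrier N \<Longrightarrow> Ad N A a 0 = 0"
  using Ad_add[of a 0 0] lie_algebra_zero by simp

text \<open>All brackets with \<open>z\<close> vanish, so the pairing with every
  \<open>\<xi>\<close> is constant in the group element.\<close>

lemma Ad_lie_center:
  assumes conn: "connected (carrier N)" and z: "z \<in> lie_center N A" and a: "a \<in> carrier N"
  shows "Ad N A a z = z"
proof -
  obtain c where c: "c \<in> charts_at A \<one>" by (rule ex_chart_one)
  have zL: "z \<in> lie_algebra N A" using z by (simp add: lie_center_def)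
  have "lie_bracket N A x z = 0" if "x \<in> lie_algebra N A" for x
    using z that lie_bracket_skew[of x z] by (simp add: lie_center_def)
  then have "Ad N A a z c \<bullet> \<xi> = z c \<bullet> \<xi>" for \<xi>
    by (intro Ad_inner_constant[OF conn c zL _ a]) (simp add: Ad_zero)
  then have "Ad N A a z c = z c" by (intro vector_eq_rdot[THEN iffD1]) (simp add: inner_commute)
  then show ?thesis by (intro lie_algebra_eqI[OF Ad_closed[OF a zL] zL c])
qed

text \<open>Brackets are central and hence fixed by \<open>Ad\<close>, so the pairing with any
  \<open>\<xi>\<close> orthogonal to the center is constant. The double orthogonal complement then
  returns the center.\<close>

lemma Ad_diff_lie_center:
  assumes conn: "connected (carrier N)" and sub: "subspace (lie_center N A)"
    and central: "\<And>x y. x \<in> lie_algebra N A \<Longrightarrow> y \<in> lie_algebra N A \<Longrightarrow>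
      lie_bracket N A x y \<in> lie_center N A"
    and a: "a \<in> carrier N" and y: "y \<in> lie_algebra N A"
  shows "Ad N A a y - y \<in> lie_center N A"
proof -
  obtain c where c: "c \<in> charts_at A \<one>" by (rule ex_chart_one)
  \<comment> \<open>Orthogonality is taken in the coordinate space with its Euclidean inner product,
    which is not the metric on the group.\<close>
  define Z where "Z = (\<lambda>z. z c) ` lie_center N A"
  have "linear (\<lambda>z :: ('a, 'e) tangent. z c)"
    by (rule linearI) (simp_all add: scaleR_fun_def)
  then have Z: "subspace Z" unfolding Z_def using sub by (rule linear_subspace_image)
  have "(Ad N A a y c - y c) \<bullet> \<xi> = 0" if "\<xi> \<in> Z\<^sup>\<bottom>" for \<xi>
  proof -
    have "z c \<bullet> \<xi> = 0" if "z \<in> lie_center N A" for z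
      using \<open>\<xi> \<in> Z\<^sup>\<bottom>\<close> that by (auto simp: orthogonal_comp_def orthogonal_def Z_def)
    then have "Ad N A a y c \<bullet> \<xi> = y c \<bullet> \<xi>"
      by (intro Ad_inner_constant[OF conn c y _ a]) (simp add: Ad_lie_center[OF conn] central y)
    then show ?thesis by (simp add: inner_diff_left)
  qed
  then have "Ad N A a y c - y c \<in> Z\<^sup>\<bottom>\<^sup>\<bottom>"
    by (auto simp: orthogonal_comp_def orthogonal_def inner_commute)
  then have "Ad N A a y c - y c \<in> Z" by (simp only: orthogonal_comp_self[OF Z])
  then obtain z where z: "z \<in> lie_center N A" "(Ad N A a y - y) c = z c" by (auto simp: Z_def)
  have "Ad N A a y - y = z"
    using z a y c by (intro lie_algebra_eqI[of _ _ c] lie_algebra_add_diff Ad_closed) (auto simp: lie_center_def)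
  then show ?thesis using z by simp
qed

text \<open>The commutator map \<open>k\<close> takes the value \<open>\<one>\<close> at the
  identity, so it is constant only if \<open>n\<close> commutes with everything. Triviality of
  \<open>Ad\<close> makes its derivative vanish at the identity, and translations spread this over
  the group.\<close>

lemma group_center_of_Ad_trivial:
  assumes conn: "connected (carrier N)" and n: "n \<in> carrier N"
    and triv: "\<And>x. x \<in> lie_algebra N A \<Longrightarrow> Ad N A n x = x"
  shows "n \<in> group_center N"
proof -
  define k where "k b = n \<otimes> b \<otimes> inv n \<otimes> inv b" for b
  obtain c where c: "c \<in> charts_at A \<one>" by (rule ex_chart_one)
  have cA: "c \<in> A" and c1: "\<one> \<in> chart_dom c" using c by (auto simp: charts_at_one)
  have k_one: "k \<one> = \<one>" using n by (simp add: k_def)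
  have kd1: "has_mderiv c c k \<one> (\<lambda>_. 0)"
  proof -
    obtain D where D: "has_mderiv c c (\<lambda>x. n \<otimes> x \<otimes> inv n) \<one> D" using ex_has_mderiv_conj[OF c c n] ..
    have D_id: "D v = v" for v
    proof -
      obtain x where "x \<in> lie_algebra N A" "x c = v" using ex_lie_algebra_coord[OF c] by blast
      then show ?thesis using Ad_eq[OF D cA cA] triv by metis
    qed
    obtain I where I: "has_mderiv c c (\<lambda>x. inv x) \<one> I"
      using has_mderiv_inv[of c c \<one>] cA c1 by auto
    \<comment> \<open>Differentiating \<open>inv x \<otimes> x = \<one>\<close> shows that inversion
      has derivative minus the identity, which cancels the derivative of conjugation by
      \<open>n\<close> in \<open>k\<close>.\<close>
    have "has_mderiv c c (\<lambda>x. \<one>) \<one> (\<lambda>v. I v + v)"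
      by (rule has_mderiv_cong[OF has_mderiv_mult_at_one[OF I has_mderiv_ident c]])
         (use cA c1 eventually_carrier[OF one_closed] in \<open>auto elim!: eventually_mono simp: chart\<close>)
    from has_mderiv_unique[OF this has_mderiv_const] cA c1
    have "I v + v = 0" for v by (auto simp: chart fun_eq_iff)
    moreover have "has_mderiv c c k \<one> (\<lambda>v. D v + I v)"
      unfolding k_def by (rule has_mderiv_mult_at_one[OF D I c]) (use n in auto)
    ultimately show ?thesis by (simp add: D_id add.commute)
  qed
  have kd: "has_mderiv d e k q (\<lambda>_. 0)"
    if d: "d \<in> A" "q \<in> chart_dom d" and e: "e \<in> A" "k q \<in> chart_dom e" for d e q
  proof -
    have q: "q \<in> carrier N" using chart_dom_carrier[OF d] .
    \<comment> \<open>With this \<open>b\<close> one has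
      \<open>k x = b \<otimes> k (inv q \<otimes> x) \<otimes> inv q\<close>, so near
      \<open>q\<close> the map \<open>k\<close> is its own behaviour near the identity, framed by
      translations.\<close>
    define b where "b = n \<otimes> q \<otimes> inv n"
    have b: "b \<in> carrier N" using q n by (simp add: b_def)
    obtain m where m: "m \<in> A" "b \<in> chart_dom m" using ex_chart[OF b] by blast
    obtain D1 where "has_mderiv d c (\<lambda>x. inv q \<otimes> x) q D1"
      using ex_has_mderiv_left_mult[of d c "inv q" q] d q cA c1 by auto
    moreover have "has_mderiv c c k (inv q \<otimes> q) (\<lambda>_. 0)" using kd1 q by simp
    ultimately have "has_mderiv d c (\<lambda>x. k (inv q \<otimes> x)) q (\<lambda>_. 0)"
      by (rule has_mderiv_compose)
    moreover obtain D2 where "has_mderiv c m (\<lambda>x. b \<otimes> x) \<one> D2"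
      using ex_has_mderiv_left_mult[of c m b \<one>] b m cA c1 by auto
    then have D2: "has_mderiv c m (\<lambda>x. b \<otimes> x) (k (inv q \<otimes> q)) D2" "D2 0 = 0"
      using q k_one by (auto dest: has_mderiv_linear linear_0)
    ultimately have "has_mderiv d m (\<lambda>x. b \<otimes> k (inv q \<otimes> x)) q (\<lambda>_. 0)"
      using has_mderiv_compose D2 by fastforce
    moreover obtain D3 where "has_mderiv m e (\<lambda>x. x \<otimes> inv q) b D3"
      using ex_has_mderiv_right_mult[of m e "inv q" b] b m q e by (auto simp: k_def b_def)
    then have D3: "has_mderiv m e (\<lambda>x. x \<otimes> inv q) (b \<otimes> k (inv q \<otimes> q)) D3" "D3 0 = 0"
      using q b k_one by (auto dest: has_mderiv_linear linear_0)
    ultimately have "has_mderiv d e (\<lambda>x. b \<otimes> k (inv q \<otimes> x) \<otimes> inv q) q (\<lambda>_. 0)"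
      using has_mderiv_compose D3 by fastforce
    then show ?thesis
    proof (rule has_mderiv_cong)
      show "\<forall>\<^sub>F x in nhds q. b \<otimes> k (inv q \<otimes> x) \<otimes> inv q = k x"
        using eventually_carrier[OF q]
      proof eventually_elim
        case (elim x)
        then show ?case using n q by (simp add: k_def b_def inv_mult_group m_assoc inv_mult_cancel)
      qed
    qed
  qed
  have "k a = k \<one>" if a: "a \<in> carrier N" for a
  proof (rule locally_constant_on_connected[OF conn open_carrier _ a one_closed])
    fix p assume p: "p \<in> carrier N"
    then have "k p \<in> carrier N" using n by (simp add: k_def)
    then obtain d e where d: "d \<in> A" "p \<in> chart_dom d" and e: "e \<in> A" "k p \<in> chart_dom e"
      using ex_chart p by meson
    \<comment> \<open>Local constancy is available for vector-valued maps, so \<open>k\<close> is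
      read in the chart \<open>e\<close>. Its coordinate map is injective on its domain, where
      \<open>k\<close> stays near \<open>p\<close>.\<close>
    have ev: "\<forall>\<^sub>F q in nhds p. k q \<in> chart_dom e"
      by (rule has_mderiv_eventually_dom[OF kd[OF d e]])
    have "\<forall>\<^sub>F q in nhds p. (chart_map e \<circ> k) q = (chart_map e \<circ> k) p"
    proof (rule locally_constant_of_derivative_zero[OF chart[OF d(1)] d(2)])
      show "\<forall>\<^sub>F q in nhds p. ((chart_map e \<circ> k \<circ> chart_inv d) has_derivative (\<lambda>_. 0)) (at (chart_map d q))"
        using ev eventually_nhds_in_open[OF open_chart_dom[OF chart[OF d(1)]] d(2)]
        by eventually_elim (rule has_mderivD(6)[OF kd[OF d(1) _ e(1)]])
    qed
    with ev show "\<forall>\<^sub>F q in nhds p. k q = k p"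
      by eventually_elim (use e chart_inv_map[OF chart[OF e(1)]] in \<open>metis o_apply\<close>)
  qed
  then have "n \<otimes> a = a \<otimes> n" if "a \<in> carrier N" for a
  proof -
    have "n \<otimes> a \<otimes> inv (a \<otimes> n) = \<one>"
      using \<open>\<And>a. a \<in> carrier N \<Longrightarrow> k a = k \<one>\<close>[OF that] that n k_one
      by (simp add: k_def inv_mult_group m_assoc)
    then show ?thesis using that n by (metis inv_equality inv_inv inv_closed m_closed)
  qed
  then show ?thesis using n by (simp add: group_center_def)
qed

end

section \<open>Invariant complements of the center\<close>

theorem lemma5p1:
  fixes N :: "'a::{t2_space,second_countable_topology} monoid"
    and A :: "('a, 'e::euclidean_space) chart set"
    and g :: "'a \<Rightarrow> ('a, 'e) tangent \<Rightarrow> ('a, 'e) tangent \<Rightarrow> real"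
    and V :: "('a, 'e) tangent set"
    and n :: 'a
  assumes "lie_group N A"
    and "simply_connected (carrier N)"
    and "step_nilpotent 2 N A"
    and "bi_invariant_metric N A g"
    and "internal_direct_sum (lie_algebra N A) (lie_center N A) V"
    and "n \<in> carrier N" and "n \<notin> group_center N"
  shows "\<not> Ad N A n ` V \<subseteq> V"
proof
  assume preserved: "Ad N A n ` V \<subseteq> V"
  interpret Lie_group N A
    using assms(1) by (simp add: Lie_group_def Lie_group_axioms_def lie_group_def)
  note n = assms(6)
  have conn: "connected (carrier N)" using assms(2) by (rule simply_connected_imp_connected_topological)
  have sub: "subspace (lie_center N A)" "subspace V"
    and sum: "lie_algebra N A = {z + v | z v. z \<in> lie_center N A \<and> v \<in> V}"
    and meet: "lie_center N A \<inter> V = {0}"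
    using assms(5) by (auto simp: internal_direct_sum_def)
  \<comment> \<open>The series starts at index 0 with the whole algebra, so the term of index 2
    contains all double brackets.\<close>
  have "lower_central_series N A (Suc (Suc 0)) = {0}"
    using assms(3) by (simp add: step_nilpotent_def numeral_2_eq_2)
  then have "lie_bracket N A w (lie_bracket N A x y) = 0"
    if "w \<in> lie_algebra N A" "x \<in> lie_algebra N A" "y \<in> lie_algebra N A" for w x y
    using that by (force intro: span_base)
  \<comment> \<open>\<open>lie_center\<close> has the central element in the first slot of the
    bracket, while the series has it in the second; skew symmetry mediates.\<close>
  then have central: "lie_bracket N A x y \<in> lie_center N A"
    if "x \<in> lie_algebra N A" "y \<in> lie_algebra N A" for x y
    using that lie_bracket_closed[OF that] lie_bracket_skew[of "lie_bracket N A x y"]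
    by (simp add: lie_center_def)
  have fix_V: "Ad N A n v = v" if v: "v \<in> V" for v
  proof -
    \<comment> \<open>Here \<open>v\<close> is decomposed as \<open>0 + v\<close>.\<close>
    have "v \<in> lie_algebra N A" using v subspace_0[OF sub(1)] unfolding sum by force
    then have "Ad N A n v - v \<in> lie_center N A"
      by (intro Ad_diff_lie_center[OF conn sub(1) _ n] central)
    moreover have "Ad N A n v - v \<in> V" using preserved v sub(2) by (auto intro: subspace_diff)
    ultimately have "Ad N A n v - v = 0" using meet by blast
    then show ?thesis by simp
  qed
  have "Ad N A n x = x" if "x \<in> lie_algebra N A" for x
  proof -
    obtain z v where x: "x = z + v" "z \<in> lie_center N A" "v \<in> V" using \<open>x \<in> _\<close> sum by auto
    moreover have "v \<in> lie_algebra N A" using x subspace_0[OF sub(1)] unfolding sum by force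
    ultimately show ?thesis
      using Ad_add[OF n, of z v] Ad_lie_center[OF conn _ n] fix_V by (simp add: lie_center_def)
  qed
  then have "n \<in> group_center N" by (rule group_center_of_Ad_trivial[OF conn n])
  with assms(7) show False ..
qed

end
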